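(* Suppose $(\lambda_h,\boldsymbol\sigma_h,u_h)$ is an eigenpair of the discrete mixed eigenvalue problem and $(\lambda,\boldsymbol\sigma,u)$ is the corresponding eigenpair of the continuous mixed eigenvalue problem, with $u\in H^3(\Omega)$. Then, as $h\to0$, $$\lambda_h-\lambda=(\boldsymbol\sigma-\boldsymbol\sigma_I,\boldsymbol\sigma_h)+O(h^4),$$ where $\boldsymbol\sigma_I$ is the Raviart-Thomas interpolation of $\boldsymbol\sigma$.
   Context: $\Omega\subset\mathbb R^2$ is a connected bounded domain that can be divided into non-overlapping axis-parallel rectangles without hanging nodes. $\mathcal T_h$ is a rectangular mesh of $\overline\Omega$ obtained from grid lines $x_0<\dots<x_{n_1}$, $y_0<\dots<y_{n_2}$: its elements are the cells $K_{i,j}=[x_{i-1},x_i]\times[y_{j-1},y_j]$ contained in $\overline\Omega$, of size $h_{x_i}\times h_{y_j}$, and $h=\max\{h_{x_i},h_{y_j}\}$. One considers a family of such meshes with $h\to0$. $(\cdot,\cdot)$ and $\|\cdot\|_0$ are the $L^2(\Omega)$ inner product and norm. $\boldsymbol\Sigma=\boldsymbol H(\operatorname{div},\Omega)$, $V=L^2(\Omega)$. With $Q_{mn}=\operatorname{span}\{x^iy^j:0\le i\le m,0\le j\le n\}$, $\boldsymbol\Sigma_h=\{\boldsymbol\tau_h\in\boldsymbol\Sigma:\boldsymbol\tau_h|_K\in Q_{10}(K)\times Q_{01}(K)\ \forall K\in\mathcal T_h\}$ and $V_h=\{v_h\in V: v_h|_K \text{ constant }\forall K\in\mathcal T_h\}$.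 Continuous problem (mixed form of $-\Delta u=\lambda u$ in $\Omega$, $u=0$ on $\partial\Omega$, with $\boldsymbol\sigma=-\nabla u$): find $(\lambda,\boldsymbol\sigma,u)\in\mathbb R\times\boldsymbol\Sigma\times V$ with $(\boldsymbol\sigma,\boldsymbol\tau)-(\operatorname{div}\boldsymbol\tau,u)=0$ and $(\operatorname{div}\boldsymbol\sigma,v)=\lambda(u,v)$ for all $(\boldsymbol\tau,v)\in\boldsymbol\Sigma\times V$; eigenvalues $0<\lambda_1\le\lambda_2\le\cdots$, $L^2$-orthonormal $u_k$. Discrete problem: find $(\lambda_h,\boldsymbol\sigma_h,u_h)\in\mathbb R\times\boldsymbol\Sigma_h\times V_h$ with $(\boldsymbol\sigma_h,\boldsymbol\tau_h)-(\operatorname{div}\boldsymbol\tau_h,u_h)=0$ and $(\operatorname{div}\boldsymbol\sigma_h,v_h)=\lambda_h(u_h,v_h)$ for all $(\boldsymbol\tau_h,v_h)\in\boldsymbol\Sigma_h\times V_h$; eigenvalues $0<\lambda_{1,h}\le\lambda_{2,h}\le\cdots$, $L^2$-orthonormal $u_{k,h}$. "Corresponding": for a fixed index $k$, $(\lambda_h,\boldsymbol\sigma_h,u_h)=(\lambda_{k,h},\boldsymbol\sigma_{k,h},u_{k,h})$, $\lambda=\lambda_k$, and $u$ is the element of the eigenspace $E_k=\operatorname{span}\{u_j:\lambda_j=\lambda_k\}$ with $\|u\|_0=1$ whose $L^2$-orthogonal projection onto $E_{k,h}=\operatorname{span}\{u_{j,h}:\lambda_j=\lambda_k\}$ is a positive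 multiple of $u_{k,h}$ (for a simple eigenvalue this just fixes the sign; for a multiple eigenvalue $u$ may depend on $h$); $\boldsymbol\sigma=-\nabla u$. The standard a priori estimates $\lambda_h-\lambda=O(h^2)$, $\|\boldsymbol\sigma_h-\boldsymbol\sigma\|_0=O(h)$, $\|u_h-u\|_0=O(h)$ are taken as known. $\boldsymbol\sigma_I\in\boldsymbol\Sigma_h$ is defined by $\int_e(\boldsymbol\sigma-\boldsymbol\sigma_I)\cdot\boldsymbol n\,ds=0$ for every edge $e$ of every element of $\mathcal T_h$. $O(h^p)$ denotes a quantity bounded by $Ch^p$ for all sufficiently small $h$, with $C$ independent of $h$ ($k$ fixed). *)

theory Defs
  imports "HOL-Analysis.Analysis" "HOL-Library.Landau_Symbols"
begin

subsection \<open>Lebesgue and Sobolev spaces\<close>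

text \<open>Functions are total; only their values on the indicated set matter, and elements of
  the spaces below are representatives of classes modulo null sets.  For vector fields the
  product in the integrals is the Euclidean inner product.\<close>

definition L2 :: "'a::euclidean_space set \<Rightarrow> ('a \<Rightarrow> 'b::euclidean_space) set" where
  "L2 S = {f \<in> borel_measurable (lebesgue_on S). integrable (lebesgue_on S) (\<lambda>z. (norm (f z))\<^sup>2)}"

definition L2_inner ::
    "'a::euclidean_space set \<Rightarrow> ('a \<Rightarrow> 'b::euclidean_space) \<Rightarrow> ('a \<Rightarrow> 'b) \<Rightarrow> real" where
  "L2_inner S f g = (LINT z|lebesgue_on S. f z \<bullet> g z)"

definition L2_norm :: "'a::euclidean_space set \<Rightarrow> ('a \<Rightarrow> 'b::euclidean_space) \<Rightarrow> real" where
  "L2_norm S f = sqrt (L2_inner S f f)"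

text \<open>\<open>D m n\<close> is the partial derivative of order \<open>m\<close> in the first and \<open>n\<close> in the second
  variable; all of them are required to exist as Frechet differentiable functions, so this is
  membership in \<open>C\<^sup>\<infinity>\<close> of the plane.\<close>

definition smooth_fun :: "(real \<times> real \<Rightarrow> real) \<Rightarrow> bool" where
  "smooth_fun \<phi> \<longleftrightarrow> (\<exists>D :: nat \<Rightarrow> nat \<Rightarrow> real \<times> real \<Rightarrow> real. D 0 0 = \<phi> \<and>
     (\<forall>m n z. (D m n has_derivative (\<lambda>w. fst w * D (Suc m) n z + snd w * D m (Suc n) z)) (at z)))"

definition test_fun :: "(real \<times> real) set \<Rightarrow> (real \<times> real \<Rightarrow> real) \<Rightarrow> bool" where
  "test_fun \<Omega> \<phi> \<longleftrightarrow> smooth_fun \<phi> \<and> (\<exists>C. compact C \<and> C \<subseteq> \<Omega> \<and> (\<forall>z. z \<notin> C \<longrightarrow> \<phi> z = 0))"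

definition grad :: "(real \<times> real \<Rightarrow> real) \<Rightarrow> real \<times> real \<Rightarrow> real \<times> real" where
  "grad \<phi> z = (frechet_derivative \<phi> (at z) (1, 0), frechet_derivative \<phi> (at z) (0, 1))"

definition has_weak_grad ::
    "(real \<times> real) set \<Rightarrow> (real \<times> real \<Rightarrow> real) \<Rightarrow> (real \<times> real \<Rightarrow> real \<times> real) \<Rightarrow> bool" where
  "has_weak_grad \<Omega> f G \<longleftrightarrow> (\<forall>\<phi>. test_fun \<Omega> \<phi> \<longrightarrow>
     (LINT z|lebesgue_on \<Omega>. f z *\<^sub>R grad \<phi> z) = - (LINT z|lebesgue_on \<Omega>. \<phi> z *\<^sub>R G z))"

definition has_weak_div ::
    "(real \<times> real) set \<Rightarrow> (real \<times> real \<Rightarrow> real \<times> real) \<Rightarrow> (real \<times> real \<Rightarrow> real) \<Rightarrow> bool" where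
  "has_weak_div \<Omega> \<tau> d \<longleftrightarrow> (\<forall>\<phi>. test_fun \<Omega> \<phi> \<longrightarrow>
     (LINT z|lebesgue_on \<Omega>. \<tau> z \<bullet> grad \<phi> z) = - (LINT z|lebesgue_on \<Omega>. d z * \<phi> z))"

primrec sobolev :: "nat \<Rightarrow> (real \<times> real) set \<Rightarrow> (real \<times> real \<Rightarrow> real) set" where
  "sobolev 0 \<Omega> = L2 \<Omega>"
| "sobolev (Suc m) \<Omega> = {f \<in> L2 \<Omega>. \<exists>G. has_weak_grad \<Omega> f G \<and>
     (\<lambda>z. fst (G z)) \<in> sobolev m \<Omega> \<and> (\<lambda>z. snd (G z)) \<in> sobolev m \<Omega>}"

definition Hdiv :: "(real \<times> real) set \<Rightarrow> (real \<times> real \<Rightarrow> real \<times> real) set" where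
  "Hdiv \<Omega> = {\<tau> \<in> L2 \<Omega>. \<exists>d \<in> L2 \<Omega>. has_weak_div \<Omega> \<tau> d}"

text \<open>The weak divergence is determined almost everywhere; a representative is chosen.\<close>

definition wdiv :: "(real \<times> real) set \<Rightarrow> (real \<times> real \<Rightarrow> real \<times> real) \<Rightarrow> real \<times> real \<Rightarrow> real" where
  "wdiv \<Omega> \<tau> = (SOME d. d \<in> L2 \<Omega> \<and> has_weak_div \<Omega> \<tau> d)"

subsection \<open>Rectangular meshes\<close>

text \<open>Grid lines \<open>gx 0 < \<dots> < gx nx\<close> and \<open>gy 0 < \<dots> < gy ny\<close>.  Cells are indexed from \<open>0\<close>, so
  \<open>cell M i j\<close> is \<open>K\<close> with indices \<open>i + 1\<close> and \<open>j + 1\<close> in the usual numbering.\<close>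

record grid =
  nx :: nat
  ny :: nat
  gx :: "nat \<Rightarrow> real"
  gy :: "nat \<Rightarrow> real"

definition cell :: "grid \<Rightarrow> nat \<Rightarrow> nat \<Rightarrow> (real \<times> real) set" where
  "cell M i j = {gx M i .. gx M (Suc i)} \<times> {gy M j .. gy M (Suc j)}"

definition elems :: "(real \<times> real) set \<Rightarrow> grid \<Rightarrow> (nat \<times> nat) set" where
  "elems \<Omega> M = {(i, j). i < nx M \<and> j < ny M \<and> cell M i j \<subseteq> closure \<Omega>}"

text \<open>The last two conjuncts say that the elements subdivide \<open>\<Omega>\<close>.  Being cells of one grid,
  they do not overlap and produce no hanging nodes.  Cell interiors lie in \<open>\<Omega>\<close>, so \<open>\<Omega>\<close>
  and its closure differ only by parts of cell edges.\<close>

definition is_mesh :: "(real \<times> real) set \<Rightarrow> grid \<Rightarrow> bool" where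
  "is_mesh \<Omega> M \<longleftrightarrow> strict_mono_on {..nx M} (gx M) \<and> strict_mono_on {..ny M} (gy M) \<and>
     closure \<Omega> = (\<Union>(i, j) \<in> elems \<Omega> M. cell M i j) \<and>
     (\<forall>(i, j) \<in> elems \<Omega> M. interior (cell M i j) \<subseteq> \<Omega>)"

definition meshsize :: "grid \<Rightarrow> real" where
  "meshsize M = Max ((\<lambda>i. gx M (Suc i) - gx M i) ` {..<nx M} \<union>
                     (\<lambda>j. gy M (Suc j) - gy M j) ` {..<ny M})"

subsection \<open>Finite element spaces\<close>

definition Qpoly :: "nat \<Rightarrow> nat \<Rightarrow> (real \<times> real \<Rightarrow> real) set" where
  "Qpoly m n = {p. \<exists>c :: nat \<Rightarrow> nat \<Rightarrow> real. p = (\<lambda>(x, y). \<Sum>i\<le>m. \<Sum>j\<le>n. c i j * x ^ i * y ^ j)}"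

definition RT_space :: "(real \<times> real) set \<Rightarrow> grid \<Rightarrow> (real \<times> real \<Rightarrow> real \<times> real) set" where
  "RT_space \<Omega> M = {\<tau> \<in> Hdiv \<Omega>. \<forall>(i, j) \<in> elems \<Omega> M. \<exists>p \<in> Qpoly 1 0. \<exists>q \<in> Qpoly 0 1.
     AE z in lebesgue_on (cell M i j). \<tau> z = (p z, q z)}"

definition P0_space :: "(real \<times> real) set \<Rightarrow> grid \<Rightarrow> (real \<times> real \<Rightarrow> real) set" where
  "P0_space \<Omega> M = {v \<in> L2 \<Omega>. \<forall>(i, j) \<in> elems \<Omega> M. \<exists>c.
     AE z in lebesgue_on (cell M i j). v z = c}"

subsection \<open>Traces and Raviart--Thomas interpolation\<close>

text \<open>The trace on the boundary of \<open>[a,b] \<times> [c,d]\<close> of an \<open>H\<^sup>1\<close> function \<open>w\<close> on its interior: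
  the limit, in \<open>L\<^sup>2\<close> of every edge, of restrictions of smooth functions that converge to
  \<open>w\<close> in \<open>H\<^sup>1\<close>.  Only the values of \<open>t\<close> on the boundary matter.\<close>

definition has_trace :: "real \<Rightarrow> real \<Rightarrow> real \<Rightarrow> real \<Rightarrow>
    (real \<times> real \<Rightarrow> real) \<Rightarrow> (real \<times> real \<Rightarrow> real) \<Rightarrow> bool" where
  "has_trace a b c d w t \<longleftrightarrow> (let K = {a<..<b} \<times> {c<..<d} in
     w \<in> L2 K \<and>
     (\<exists>G \<phi>. G \<in> L2 K \<and> has_weak_grad K w G \<and> (\<forall>n::nat. smooth_fun (\<phi> n)) \<and>
        (\<lambda>n. L2_norm K (\<lambda>z. \<phi> n z - w z)) \<longlonglongrightarrow> 0 \<and>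
        (\<lambda>n. L2_norm K (\<lambda>z. grad (\<phi> n) z - G z)) \<longlonglongrightarrow> 0 \<and>
        (\<forall>x \<in> {a, b}. (\<lambda>s. t (x, s)) \<in> L2 {c..d} \<and>
           (\<lambda>n. L2_norm {c..d} (\<lambda>s. \<phi> n (x, s) - t (x, s))) \<longlonglongrightarrow> 0) \<and>
        (\<forall>y \<in> {c, d}. (\<lambda>s. t (s, y)) \<in> L2 {a..b} \<and>
           (\<lambda>n. L2_norm {a..b} (\<lambda>s. \<phi> n (s, y) - t (s, y))) \<longlonglongrightarrow> 0)))"

text \<open>Vanishing of the integral of \<open>w \<bullet> n\<close> over each of the four edges of \<open>[a,b] \<times> [c,d]\<close>, with
  the trace taken from inside.  The orientation of the normal is irrelevant here.\<close>

definition zero_edge_fluxes ::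
    "real \<Rightarrow> real \<Rightarrow> real \<Rightarrow> real \<Rightarrow> (real \<times> real \<Rightarrow> real \<times> real) \<Rightarrow> bool" where
  "zero_edge_fluxes a b c d w \<longleftrightarrow> (\<exists>t :: real \<times> real \<Rightarrow> real \<times> real.
     has_trace a b c d (\<lambda>z. fst (w z)) (\<lambda>z. fst (t z)) \<and>
     has_trace a b c d (\<lambda>z. snd (w z)) (\<lambda>z. snd (t z)) \<and>
     (\<forall>x \<in> {a, b}. (LINT s|lebesgue_on {c..d}. t (x, s) \<bullet> (1, 0)) = 0) \<and>
     (\<forall>y \<in> {c, d}. (LINT s|lebesgue_on {a..b}. t (s, y) \<bullet> (0, 1)) = 0))"

definition is_RT_interp :: "(real \<times> real) set \<Rightarrow> grid \<Rightarrow>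
    (real \<times> real \<Rightarrow> real \<times> real) \<Rightarrow> (real \<times> real \<Rightarrow> real \<times> real) \<Rightarrow> bool" where
  "is_RT_interp \<Omega> M \<sigma> \<sigma>I \<longleftrightarrow> \<sigma>I \<in> RT_space \<Omega> M \<and>
     (\<forall>(i, j) \<in> elems \<Omega> M.
        zero_edge_fluxes (gx M i) (gx M (Suc i)) (gy M j) (gy M (Suc j)) (\<lambda>z. \<sigma> z - \<sigma>I z))"

subsection \<open>Mixed eigenvalue problems\<close>

text \<open>The continuous problem is the case \<open>S = Hdiv \<Omega>\<close>, \<open>V = L2 \<Omega>\<close>, the discrete one the case
  \<open>S = RT_space \<Omega> M\<close>, \<open>V = P0_space \<Omega> M\<close>.  Nontriviality of \<open>u\<close> is not part of this
  predicate; it will come from normalization.\<close>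

definition mixed_solution :: "(real \<times> real) set \<Rightarrow> (real \<times> real \<Rightarrow> real \<times> real) set \<Rightarrow>
    (real \<times> real \<Rightarrow> real) set \<Rightarrow> real \<Rightarrow> (real \<times> real \<Rightarrow> real \<times> real) \<Rightarrow> (real \<times> real \<Rightarrow> real) \<Rightarrow> bool" where
  "mixed_solution \<Omega> S V \<mu> \<sigma> u \<longleftrightarrow> \<sigma> \<in> S \<and> u \<in> V \<and>
     (\<forall>\<tau> \<in> S. L2_inner \<Omega> \<sigma> \<tau> - L2_inner \<Omega> (wdiv \<Omega> \<tau>) u = 0) \<and>
     (\<forall>v \<in> V. L2_inner \<Omega> (wdiv \<Omega> \<sigma>) v = \<mu> * L2_inner \<Omega> u v)"

definition L2_span ::
    "(real \<times> real) set \<Rightarrow> ('j \<Rightarrow> real \<times> real \<Rightarrow> real) \<Rightarrow> 'j set \<Rightarrow> (real \<times> real \<Rightarrow> real) set" where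
  "L2_span \<Omega> u J = {v. \<exists>c. AE z in lebesgue_on \<Omega>. v z = (\<Sum>j\<in>J. c j * u j z)}"

text \<open>\<open>(lam j, sig j, u j)\<close>, \<open>j \<in> J\<close>, is an enumeration of all eigenvalues in nondecreasing order,
  repeated according to their (finite) multiplicities, with orthonormal eigenfunctions.
  The last conjunct says that the list is complete: every solution lies in the span of the
  listed eigenfunctions with that eigenvalue (and vanishes if there are none).\<close>

definition eigen_enum :: "(real \<times> real) set \<Rightarrow> (real \<times> real \<Rightarrow> real \<times> real) set \<Rightarrow>
    (real \<times> real \<Rightarrow> real) set \<Rightarrow> nat set \<Rightarrow> (nat \<Rightarrow> real) \<Rightarrow>
    (nat \<Rightarrow> real \<times> real \<Rightarrow> real \<times> real) \<Rightarrow> (nat \<Rightarrow> real \<times> real \<Rightarrow> real) \<Rightarrow> bool" where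
  "eigen_enum \<Omega> S V J lam sig u \<longleftrightarrow>
     (\<forall>j \<in> J. 0 < lam j \<and> mixed_solution \<Omega> S V (lam j) (sig j) (u j)) \<and>
     mono_on J lam \<and>
     (\<forall>i \<in> J. \<forall>j \<in> J. L2_inner \<Omega> (u i) (u j) = (if i = j then 1 else 0)) \<and>
     (\<forall>\<mu>. finite {j \<in> J. lam j = \<mu>}) \<and>
     (\<forall>\<mu> \<tau> v. mixed_solution \<Omega> S V \<mu> \<tau> v \<longrightarrow> v \<in> L2_span \<Omega> u {j \<in> J. lam j = \<mu>})"

definition is_L2_projection :: "(real \<times> real) set \<Rightarrow> (real \<times> real \<Rightarrow> real) set \<Rightarrow>
    (real \<times> real \<Rightarrow> real) \<Rightarrow> (real \<times> real \<Rightarrow> real) \<Rightarrow> bool" where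
  "is_L2_projection \<Omega> E f p \<longleftrightarrow> p \<in> E \<and> (\<forall>w \<in> E. L2_inner \<Omega> (\<lambda>z. f z - p z) w = 0)"

text \<open>\<open>(lam k, \<sigma>, u)\<close> is the continuous eigenpair corresponding to the \<open>k\<close>-th discrete one.
  \<open>lam\<close>, \<open>us\<close> are the continuous eigenvalues and eigenfunctions, \<open>uh\<close> the \<open>N\<close> discrete
  eigenfunctions.  The discrete counterpart of the eigenspace is spanned by the
  \<open>uh j\<close> whose index \<open>j\<close> satisfies \<open>lam j = lam k\<close> for the continuous eigenvalues.\<close>

definition corresponding :: "(real \<times> real) set \<Rightarrow> (nat \<Rightarrow> real) \<Rightarrow> (nat \<Rightarrow> real \<times> real \<Rightarrow> real) \<Rightarrow>
    nat \<Rightarrow> (nat \<Rightarrow> real \<times> real \<Rightarrow> real) \<Rightarrow> nat \<Rightarrow>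
    (real \<times> real \<Rightarrow> real \<times> real) \<Rightarrow> (real \<times> real \<Rightarrow> real) \<Rightarrow> bool" where
  "corresponding \<Omega> lam us N uh k \<sigma> u \<longleftrightarrow>
     mixed_solution \<Omega> (Hdiv \<Omega>) (L2 \<Omega>) (lam k) \<sigma> u \<and>
     u \<in> L2_span \<Omega> us {j \<in> {1..}. lam j = lam k} \<and>
     has_weak_grad \<Omega> u (\<lambda>z. - \<sigma> z) \<and>
     L2_norm \<Omega> u = 1 \<and>
     (\<exists>a>0. is_L2_projection \<Omega> (L2_span \<Omega> uh {j \<in> {1..N}. lam j = lam k}) u (\<lambda>z. a * uh k z))"

end

theory Submission
  imports Defs "HOL-Computational_Algebra.Polynomial" "HOL-Real_Asymp.Real_Asymp"
begin

text \<open>Testing the continuous problem with \<open>\<sigma>\<^sub>h\<close> and the discrete one with \<open>\<sigma>\<^sub>I\<close> gives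
  \<open>(\<sigma>, \<sigma>\<^sub>h) = (div \<sigma>\<^sub>h, u) = \<lambda>\<^sub>h (u, u\<^sub>h)\<close> and \<open>(\<sigma>\<^sub>I, \<sigma>\<^sub>h) = (div \<sigma>\<^sub>I, u\<^sub>h) = (div \<sigma>, u\<^sub>h) = \<lambda> (u, u\<^sub>h)\<close>,
  because \<open>div \<sigma>\<^sub>h\<close> is piecewise constant, hence equal to \<open>\<lambda>\<^sub>h u\<^sub>h\<close>, and because \<open>div (\<sigma> - \<sigma>\<^sub>I)\<close> has
  integral zero over every element.  As \<open>2 - 2 (u, u\<^sub>h) = \<parallel>u\<^sub>h - u\<parallel>\<^sup>2\<close>, the error term is exactly
  \<open>(\<lambda>\<^sub>h - \<lambda>) \<parallel>u\<^sub>h - u\<parallel>\<^sup>2 / 2\<close>, which the a priori estimates bound by \<open>O(h\<^sup>4)\<close>.\<close>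

subsection \<open>Smooth cutoff functions\<close>

text \<open>Allowing an arbitrary polynomial factor makes this class closed under differentiation.\<close>

definition flat :: "real poly \<Rightarrow> real \<Rightarrow> real" where
  "flat p x = (if x \<le> 0 then 0 else poly p (1 / x) * exp (- (1 / x)))"

lemma poly_exp_tendsto_0: "((\<lambda>t::real. poly p t * exp (- t)) \<longlongrightarrow> 0) at_top"
proof -
  have "((\<lambda>t::real. \<Sum>i\<le>degree p. coeff p i * (t ^ i / exp t)) \<longlongrightarrow> (\<Sum>i\<le>degree p. coeff p i * 0)) at_top"
    by (intro tendsto_sum tendsto_mult tendsto_const tendsto_power_div_exp_0)
  moreover have "(\<lambda>t::real. \<Sum>i\<le>degree p. coeff p i * (t ^ i / exp t)) = (\<lambda>t. poly p t * exp (- t))"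
    by (simp add: poly_altdef sum_distrib_right exp_minus divide_inverse mult.assoc)
  ultimately show ?thesis by simp
qed

lemma flat_tendsto_0: "(flat p \<longlongrightarrow> 0) (at 0)"
proof -
  have "((\<lambda>x. poly p (1 / x) * exp (- (1 / x))) \<longlongrightarrow> 0) (at_right 0)"
    using filterlim_compose[OF poly_exp_tendsto_0 filterlim_inverse_at_top_right]
    by (simp add: divide_inverse)
  then have "(flat p \<longlongrightarrow> 0) (at_right 0)"
    by (rule Lim_transform_eventually) (auto simp: flat_def eventually_at_filter)
  moreover have "(flat p \<longlongrightarrow> 0) (at_left 0)"
    by (rule Lim_transform_eventually[OF tendsto_const]) (auto simp: flat_def eventually_at_filter)
  ultimately show ?thesis by (simp add: filterlim_split_at)
qed

text \<open>With \<open>t = 1 / x\<close>, the derivative of \<open>p(t) * exp (- t)\<close> is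
  \<open>t\<^sup>2 * (p(t) - p'(t)) * exp (- t)\<close>; the list \<open>[:0, 0, 1:]\<close> is the
  polynomial \<open>t\<^sup>2\<close>.\<close>

lemma flat_has_real_derivative:
  "(flat p has_real_derivative flat ([:0, 0, 1:] * (p - pderiv p)) x) (at x)"
proof (cases x "0::real" rule: linorder_cases)
  case less
  have "((\<lambda>_. 0) has_real_derivative 0) (at x)" by simp
  then have "(flat p has_real_derivative 0) (at x)"
    by (rule has_field_derivative_transform_within_open[of _ _ _ "{..<0}"])
      (use less in \<open>auto simp: flat_def\<close>)
  then show ?thesis using less by (simp add: flat_def)
next
  case equal
  \<comment> \<open>Dividing by \<open>h\<close> multiplies the polynomial in \<open>1 / h\<close>
    by its variable, which is \<open>pCons 0\<close>. At \<open>h = 0\<close> both sides are zero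
    because division by zero yields zero.\<close>
  have "(\<lambda>h. (flat p (0 + h) - flat p 0) / h) = flat (pCons 0 p)"
    by (auto simp: flat_def fun_eq_iff)
  then have "(flat p has_real_derivative 0) (at 0)"
    using flat_tendsto_0[of "pCons 0 p"] by (simp add: DERIV_def)
  then show ?thesis using equal by (simp add: flat_def)
next
  case greater
  have "((\<lambda>x. poly p (1 / x) * exp (- (1 / x))) has_real_derivative
      flat ([:0, 0, 1:] * (p - pderiv p)) x) (at x)"
    using greater
    by (auto intro!: derivative_eq_intros DERIV_chain2[OF poly_DERIV]
        simp: flat_def field_simps power2_eq_square)
  then show ?thesis
    by (rule has_field_derivative_transform_within_open[of _ _ _ "{0<..}"])
      (use greater in \<open>auto simp: flat_def\<close>)
qed

text \<open>Sums and products make the class stable under the product rule, and affine arguments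
  allow reflection and scaling, as needed for cutoffs of an interval.\<close>

inductive flat_gen :: "(real \<Rightarrow> real) \<Rightarrow> bool" where
  flat_gen_affine: "flat_gen (\<lambda>x. flat p (c * x + e))"
| flat_gen_add: "flat_gen f \<Longrightarrow> flat_gen g \<Longrightarrow> flat_gen (\<lambda>x. f x + g x)"
| flat_gen_mult: "flat_gen f \<Longrightarrow> flat_gen g \<Longrightarrow> flat_gen (\<lambda>x. f x * g x)"

lemma flat_gen_derivative:
  assumes "flat_gen f"
  shows "\<exists>f'. flat_gen f' \<and> (\<forall>x. (f has_real_derivative f' x) (at x))"
  using assms
proof induction
  case (flat_gen_affine p c e)
  let ?q = "[:0, 0, 1:] * (p - pderiv p)"
  \<comment> \<open>The inner derivative \<open>c\<close> is absorbed into the polynomial, so the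
    derivative is again a generator.\<close>
  have "((\<lambda>x. flat p (c * x + e)) has_real_derivative flat (smult c ?q) (c * x + e)) (at x)" for x
  proof -
    have "((\<lambda>x. flat p (c * x + e)) has_real_derivative flat ?q (c * x + e) * c) (at x)"
      by (rule DERIV_chain2[OF flat_has_real_derivative]) (auto intro!: derivative_eq_intros)
    moreover have "flat ?q (c * x + e) * c = flat (smult c ?q) (c * x + e)"
      by (simp add: flat_def mult_ac)
    ultimately show ?thesis by metis
  qed
  then show ?case using flat_gen.flat_gen_affine by blast
next
  case (flat_gen_add f g)
  then obtain f' g' where "flat_gen f'" "flat_gen g'"
    "\<And>x. (f has_real_derivative f' x) (at x)" "\<And>x. (g has_real_derivative g' x) (at x)"
    by blast
  then show ?case
    by (intro exI[of _ "\<lambda>x. f' x + g' x"] conjI allI flat_gen.flat_gen_add DERIV_add)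
next
  case (flat_gen_mult f g)
  then obtain f' g' where "flat_gen f'" "flat_gen g'"
    "\<And>x. (f has_real_derivative f' x) (at x)" "\<And>x. (g has_real_derivative g' x) (at x)"
    by blast
  then show ?case using flat_gen_mult(1,2)
    by (intro exI[of _ "\<lambda>x. f' x * g x + g' x * f x"] conjI allI flat_gen.flat_gen_add
        flat_gen.flat_gen_mult DERIV_mult)
qed

lemma flat_gen_derivatives:
  assumes "flat_gen f"
  obtains D :: "nat \<Rightarrow> real \<Rightarrow> real" where "D 0 = f"
    "\<And>n x. (D n has_real_derivative D (Suc n) x) (at x)"
proof -
  \<comment> \<open>Choice turns the existence of derivatives into an operator \<open>d\<close> on
    the class; its iterates are the higher derivatives.\<close>
  obtain d where d: "\<And>f. flat_gen f \<Longrightarrow> flat_gen (d f) \<and> (\<forall>x. (f has_real_derivative d f x) (at x))"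
    using flat_gen_derivative by metis
  have "flat_gen ((d ^^ n) f)" for n
    by (induction n) (use assms d in auto)
  with d show thesis by (intro that[of "\<lambda>n. (d ^^ n) f"]) auto
qed

lemma smooth_fun_product:
  assumes "flat_gen f" "flat_gen g"
  shows "smooth_fun (\<lambda>(x, y). f x * g y)"
proof -
  obtain A where A: "A 0 = f" "\<And>n x. (A n has_real_derivative A (Suc n) x) (at x)"
    using flat_gen_derivatives[OF assms(1)] by blast
  obtain B where B: "B 0 = g" "\<And>n x. (B n has_real_derivative B (Suc n) x) (at x)"
    using flat_gen_derivatives[OF assms(2)] by blast
  \<comment> \<open>The table of partial derivatives demanded by \<open>smooth_fun\<close> consists
    of the products of one-variable derivatives.\<close>
  have "((\<lambda>w. A m (fst w) * B n (snd w)) has_derivative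
      (\<lambda>w. fst w * (A (Suc m) (fst z) * B n (snd z)) + snd w * (A m (fst z) * B (Suc n) (snd z)))) (at z)"
    for m n z
  proof -
    have "((\<lambda>w. A m (fst w)) has_derivative (\<lambda>w. A (Suc m) (fst z) * fst w)) (at z)"
      using A(2)[of m "fst z"] unfolding has_field_derivative_def
      by (rule has_derivative_compose[rotated]) (auto intro!: derivative_eq_intros)
    moreover have "((\<lambda>w. B n (snd w)) has_derivative (\<lambda>w. B (Suc n) (snd z) * snd w)) (at z)"
      using B(2)[of n "snd z"] unfolding has_field_derivative_def
      by (rule has_derivative_compose[rotated]) (auto intro!: derivative_eq_intros)
    ultimately show ?thesis
      by (rule has_derivative_eq_rhs[OF has_derivative_mult]) (auto simp: algebra_simps)
  qed
  then show ?thesis unfolding smooth_fun_def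
    by (intro exI[of _ "\<lambda>m n w. A m (fst w) * B n (snd w)"]) (auto simp: A(1) B(1) fun_eq_iff)
qed

text \<open>Since \<open>flat 1 t\<close> is \<open>exp (- (1 / t))\<close> for positive
  \<open>t\<close>, this tends to 1 inside the interval as \<open>n\<close> grows, without being
  equal to 1 anywhere. The shift by 1 keeps the support at distance \<open>1 / n\<close> from both
  ends; if \<open>b \<le> a\<close>, the function is zero.\<close>

definition cutoff :: "real \<Rightarrow> real \<Rightarrow> nat \<Rightarrow> real \<Rightarrow> real" where
  "cutoff a b n x = flat 1 (real n * (x - a) - 1) * flat 1 (real n * (b - x) - 1)"

lemma flat_gen_cutoff: "flat_gen (cutoff a b n)"
proof -
  have "flat_gen (\<lambda>x. flat 1 (real n * x + (- (real n * a) - 1)) * flat 1 (- real n * x + (real n * b - 1)))"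
    by (intro flat_gen.intros)
  then show ?thesis by (simp add: cutoff_def[abs_def] algebra_simps)
qed

lemma flat_1_bounds: "0 \<le> flat 1 x" "flat 1 x \<le> 1"
  by (auto simp: flat_def)

lemma cutoff_bounds: "0 \<le> cutoff a b n x" "cutoff a b n x \<le> 1"
  by (auto simp: cutoff_def flat_1_bounds mult_le_one)

lemma cutoff_eq_0: "x \<notin> {a + 1 / Suc n .. b - 1 / Suc n} \<Longrightarrow> cutoff a b (Suc n) x = 0"
  by (auto simp: cutoff_def flat_def field_simps)

lemma cutoff_tendsto_1:
  assumes "a < x" "x < b"
  shows "(\<lambda>n. cutoff a b n x) \<longlonglongrightarrow> 1"
proof -
  have *: "(\<lambda>n. flat 1 (real n * c - 1)) \<longlonglongrightarrow> 1" if "c > 0" for c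
  proof -
    have lim: "filterlim (\<lambda>n. real n * c - 1) at_top sequentially"
      using that by real_asymp
    have "((\<lambda>x. exp (- (1 / x))) \<longlongrightarrow> (1::real)) at_top" by real_asymp
    then have "(flat 1 \<longlongrightarrow> 1) at_top"
      by (rule Lim_transform_eventually)
        (auto simp: flat_def intro: eventually_mono[OF eventually_gt_at_top[of 0]])
    then show ?thesis using lim by (rule filterlim_compose)
  qed
  have "(\<lambda>n. cutoff a b n x) \<longlonglongrightarrow> 1 * 1"
    unfolding cutoff_def using assms by (intro tendsto_mult *) auto
  then show ?thesis by simp
qed

definition cutoff2 :: "real \<Rightarrow> real \<Rightarrow> real \<Rightarrow> real \<Rightarrow> nat \<Rightarrow> real \<times> real \<Rightarrow> real" where
  "cutoff2 a b c d n = (\<lambda>(x, y). cutoff a b n x * cutoff c d n y)"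

lemma cutoff2_eq_0:
  assumes "z \<notin> {a + 1 / Suc n .. b - 1 / Suc n} \<times> {c + 1 / Suc n .. d - 1 / Suc n}"
  shows "cutoff2 a b c d (Suc n) z = 0"
proof -
  have "fst z \<notin> {a + 1 / Suc n .. b - 1 / Suc n} \<or> snd z \<notin> {c + 1 / Suc n .. d - 1 / Suc n}"
    using assms by (simp only: mem_Times_iff de_Morgan_conj)
  then have "cutoff a b (Suc n) (fst z) = 0 \<or> cutoff c d (Suc n) (snd z) = 0"
    using cutoff_eq_0 by metis
  then show ?thesis by (auto simp: cutoff2_def case_prod_beta)
qed

lemma Icc_shrink_subset:
  fixes a b e :: real
  shows "0 < e \<Longrightarrow> {a + e .. b - e} \<subseteq> {a<..<b}"
  by auto

text \<open>The index \<open>Suc n\<close> keeps the margin \<open>1 / Suc n\<close> positive, so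
  the closed rectangle that carries the function lies inside the open one.\<close>

lemma test_fun_cutoff2:
  assumes "{a<..<b} \<times> {c<..<d} \<subseteq> S"
  shows "test_fun S (cutoff2 a b c d (Suc n))"
  unfolding test_fun_def
proof (intro conjI exI)
  let ?C = "{a + 1 / Suc n .. b - 1 / Suc n} \<times> {c + 1 / Suc n .. d - 1 / Suc n}"
  show "smooth_fun (cutoff2 a b c d (Suc n))"
    unfolding cutoff2_def by (intro smooth_fun_product flat_gen_cutoff)
  show "compact ?C" by (intro compact_Times compact_Icc)
  have "?C \<subseteq> {a<..<b} \<times> {c<..<d}"
    by (intro Sigma_mono Icc_shrink_subset) simp_all
  then show "?C \<subseteq> S" using assms by blast
  show "\<forall>z. z \<notin> ?C \<longrightarrow> cutoff2 a b c d (Suc n) z = 0"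
    using cutoff2_eq_0 by blast
qed

lemma cutoff2_bounds: "\<bar>cutoff2 a b c d n z\<bar> \<le> 1"
  using cutoff_bounds by (auto simp: cutoff2_def abs_mult mult_le_one split: prod.split)

lemma cutoff2_tendsto_indicator:
  "(\<lambda>n. cutoff2 a b c d (Suc n) z) \<longlonglongrightarrow> indicator ({a<..<b} \<times> {c<..<d}) z"
proof (cases "z \<in> {a<..<b} \<times> {c<..<d}")
  case True
  then have "(\<lambda>n. cutoff2 a b c d n z) \<longlonglongrightarrow> 1 * 1"
    unfolding cutoff2_def case_prod_beta by (intro tendsto_mult cutoff_tendsto_1) auto
  from LIMSEQ_Suc[OF this] True show ?thesis by simp
next
  case False
  then have "cutoff2 a b c d (Suc n) z = 0" for n
  proof -
    have "{a + 1 / Suc n .. b - 1 / Suc n} \<times> {c + 1 / Suc n .. d - 1 / Suc n}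
        \<subseteq> {a<..<b} \<times> {c<..<d}"
      by (intro Sigma_mono Icc_shrink_subset) simp_all
    then have "z \<notin> {a + 1 / Suc n .. b - 1 / Suc n} \<times> {c + 1 / Suc n .. d - 1 / Suc n}"
      using False by blast
    then show ?thesis by (rule cutoff2_eq_0)
  qed
  then show ?thesis using False by simp
qed

lemma smooth_fun_continuous:
  assumes "smooth_fun \<phi>"
  shows "continuous_on UNIV \<phi>"
proof -
  obtain D where "D 0 0 = \<phi>" "\<And>m n z. (D m n has_derivative
      (\<lambda>w. fst w * D (Suc m) n z + snd w * D m (Suc n) z)) (at z)"
    using assms unfolding smooth_fun_def by blast
  then have "isCont \<phi> z" for z
    using has_derivative_continuous by blast
  then show ?thesis by (simp add: continuous_at_imp_continuous_on)
qed

subsection \<open>Square integrable functions\<close>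

lemma L2_borel_measurable: "f \<in> L2 S \<Longrightarrow> f \<in> borel_measurable (lebesgue_on S)"
  by (simp add: L2_def)

lemma L2_integrable_inner:
  assumes "f \<in> L2 S" "g \<in> L2 S"
  shows "integrable (lebesgue_on S) (\<lambda>z. f z \<bullet> g z)"
proof (rule Bochner_Integration.integrable_bound)
  show "integrable (lebesgue_on S) (\<lambda>z. (norm (f z))\<^sup>2 + (norm (g z))\<^sup>2)"
    using assms by (simp add: L2_def)
  show "(\<lambda>z. f z \<bullet> g z) \<in> borel_measurable (lebesgue_on S)"
    using assms by (intro borel_measurable_inner L2_borel_measurable)
  have "\<bar>x \<bullet> y\<bar> \<le> (norm x)\<^sup>2 + (norm y)\<^sup>2" for x y :: 'b
    using Cauchy_Schwarz_ineq2[of x y] sum_squares_bound[of "norm x" "norm y"]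
      mult_nonneg_nonneg[of "norm x" "norm y"] by (simp add: power2_eq_square)
  then show "AE z in lebesgue_on S. norm (f z \<bullet> g z) \<le> norm ((norm (f z))\<^sup>2 + (norm (g z))\<^sup>2)"
    by (intro AE_I2) simp
qed

lemma L2_add:
  assumes "f \<in> L2 S" "g \<in> L2 S"
  shows "(\<lambda>z. f z + g z) \<in> L2 S"
proof -
  have "integrable (lebesgue_on S) (\<lambda>z. f z \<bullet> f z + 2 * (f z \<bullet> g z) + g z \<bullet> g z)"
    using L2_integrable_inner assms by (intro Bochner_Integration.integrable_add integrable_mult_right) auto
  then show ?thesis using assms
    by (auto simp: L2_def power2_norm_eq_inner inner_add inner_commute algebra_simps)
qed

lemma L2_scale: "f \<in> L2 S \<Longrightarrow> (\<lambda>z. r * f z) \<in> L2 S" for f :: "'a::euclidean_space \<Rightarrow> real"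
  by (auto simp: L2_def power_mult_distrib)

lemma L2_uminus: "f \<in> L2 S \<Longrightarrow> (\<lambda>z. - f z) \<in> L2 S"
  by (auto simp: L2_def)

lemma L2_diff: "f \<in> L2 S \<Longrightarrow> g \<in> L2 S \<Longrightarrow> (\<lambda>z. f z - g z) \<in> L2 S"
  using L2_add[of f S "\<lambda>z. - g z"] L2_uminus[of g S] by simp

lemma L2_bounded_linear:
  assumes "bounded_linear T" "f \<in> L2 S"
  shows "(\<lambda>z. T (f z)) \<in> L2 S"
proof -
  obtain K where K: "\<And>x. norm (T x) \<le> norm x * K" "K > 0"
    using bounded_linear.pos_bounded[OF assms(1)] by blast
  have T: "T \<in> borel_measurable borel"
    using assms(1) by (intro borel_measurable_continuous_onI linear_continuous_on)
  have meas: "(\<lambda>z. T (f z)) \<in> borel_measurable (lebesgue_on S)"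
    using measurable_compose[OF L2_borel_measurable[OF assms(2)] T] .
  have le: "(norm (T x))\<^sup>2 \<le> K\<^sup>2 * (norm x)\<^sup>2" for x
    using power_mono[OF K(1) norm_ge_zero, of x 2] by (simp add: power_mult_distrib mult.commute)
  have "integrable (lebesgue_on S) (\<lambda>z. (norm (T (f z)))\<^sup>2)"
  proof (rule Bochner_Integration.integrable_bound)
    show "integrable (lebesgue_on S) (\<lambda>z. K\<^sup>2 * (norm (f z))\<^sup>2)"
      using assms(2) by (simp add: L2_def)
    show "(\<lambda>z. (norm (T (f z)))\<^sup>2) \<in> borel_measurable (lebesgue_on S)"
      using meas by simp
  qed (use le in simp)
  with meas show ?thesis by (simp add: L2_def)
qed

lemma L2_subset:
  assumes "f \<in> L2 S" "T \<subseteq> S" "S \<in> sets lebesgue" "T \<in> sets lebesgue"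
  shows "f \<in> L2 T"
proof -
  have "integrable (lebesgue_on T) (\<lambda>z. (norm (f z))\<^sup>2)"
    using assms set_integrable_subset[of lebesgue S "\<lambda>z. (norm (f z))\<^sup>2" T]
    by (simp add: L2_def integrable_restrict_space set_integrable_def)
  moreover have "f \<in> borel_measurable (lebesgue_on T)"
    using assms measurable_restrict_mono by (auto simp: L2_def)
  ultimately show ?thesis by (simp add: L2_def)
qed

lemma L2_continuous:
  fixes f :: "'a::euclidean_space \<Rightarrow> 'b::euclidean_space"
  assumes "continuous_on UNIV f" "bounded S" "S \<in> sets lebesgue"
  shows "f \<in> L2 S"
proof -
  obtain a where S: "S \<subseteq> cbox (- a) a"
    using bounded_subset_cbox_symmetric[OF assms(2)] by blast
  have "integrable (lebesgue_on (cbox (- a) a)) (\<lambda>z. (norm (f z))\<^sup>2)"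
    by (intro continuous_imp_integrable continuous_intros continuous_on_subset[OF assms(1)]) auto
  moreover have "f \<in> borel_measurable (lebesgue_on (cbox (- a) a))"
    by (intro continuous_imp_measurable_on_sets_lebesgue continuous_on_subset[OF assms(1)]) auto
  ultimately have "f \<in> L2 (cbox (- a) a)" by (simp add: L2_def)
  from this S show ?thesis by (rule L2_subset) (use assms in auto)
qed

text \<open>Constants are integrable on a bounded set, so \<open>t \<le> 1 + t\<^sup>2\<close>
  provides an integrable majorant.\<close>

lemma L2_integrable:
  assumes "f \<in> L2 S" "bounded S" "S \<in> sets lebesgue"
  shows "integrable (lebesgue_on S) f"
proof (rule Bochner_Integration.integrable_bound)
  have "(\<lambda>_. 1::real) \<in> L2 S" using assms by (intro L2_continuous) auto
  then have "integrable (lebesgue_on S) (\<lambda>_. 1::real)" by (simp add: L2_def)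
  then show "integrable (lebesgue_on S) (\<lambda>z. 1 + (norm (f z))\<^sup>2)"
    using assms by (intro Bochner_Integration.integrable_add) (auto simp: L2_def)
  have "t \<le> 1 + t\<^sup>2" if "t \<ge> 0" for t :: real
    using zero_le_power2[of "t - 1"] that by (simp add: power2_eq_square algebra_simps)
  then show "AE z in lebesgue_on S. norm (f z) \<le> norm (1 + (norm (f z))\<^sup>2)"
    by (intro AE_I2) simp
qed (use assms in \<open>simp add: L2_def\<close>)

lemma L2_norm_power2: "(L2_norm S f)\<^sup>2 = L2_inner S f f"
  unfolding L2_norm_def by (simp add: L2_inner_def)

lemma L2_norm_nonneg: "0 \<le> L2_norm S f"
  by (simp add: L2_norm_def L2_inner_def)

text \<open>Cauchy-Schwarz against the constant 1: the integral of
  \<open>(norm (f z) - t)\<^sup>2\<close> is a nonnegative quadratic polynomial in \<open>t\<close>,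
  and suitable values of \<open>t\<close> give the bound.\<close>

lemma norm_integral_le_L2_norm:
  assumes f: "f \<in> L2 S" and S: "bounded S" "S \<in> sets lebesgue"
  shows "norm (LINT z|lebesgue_on S. f z) \<le> sqrt (measure lebesgue S) * L2_norm S f"
proof -
  let ?m = "measure lebesgue S" and ?I = "LINT z|lebesgue_on S. norm (f z)"
  have int: "integrable (lebesgue_on S) (\<lambda>z. norm (f z))"
    using L2_integrable[OF assms] by simp
  have meas: "measure (lebesgue_on S) S = ?m"
    using S by (simp add: measure_restrict_space)
  have one: "integrable (lebesgue_on S) (\<lambda>_. c :: real)" for c
    using S by (intro L2_integrable L2_continuous) auto
  have quad: "0 \<le> (L2_norm S f)\<^sup>2 - 2 * t * ?I + t\<^sup>2 * ?m" for t
  proof -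
    have "0 \<le> (LINT z|lebesgue_on S. (norm (f z) - t)\<^sup>2)" by simp
    also have "\<dots> = (LINT z|lebesgue_on S. (norm (f z))\<^sup>2 - (2 * t) * norm (f z) + t\<^sup>2)"
      by (simp add: power2_diff algebra_simps)
    also have "\<dots> = (L2_norm S f)\<^sup>2 - 2 * t * ?I + t\<^sup>2 * ?m"
      using f int one[of "t\<^sup>2"]
      by (simp add: L2_norm_power2 L2_inner_def power2_norm_eq_inner L2_def meas)
    finally show ?thesis .
  qed
  have "?I\<^sup>2 \<le> ?m * (L2_norm S f)\<^sup>2"
  proof (cases "?m = 0")
    case True
    have "?I = 0"
    proof (rule ccontr)
      assume "?I \<noteq> 0"
      \<comment> \<open>For a null set the quadratic polynomial is affine in \<open>t\<close>; this
        \<open>t\<close> makes its value -1.\<close>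
      then show False using quad[of "((L2_norm S f)\<^sup>2 + 1) / (2 * ?I)"] True by simp
    qed
    with True show ?thesis by simp
  next
    case False
    then have "?m > 0" by (simp add: zero_less_measure_iff)
    \<comment> \<open>The mean value of \<open>norm (f z)\<close> minimises the quadratic
      polynomial.\<close>
    with quad[of "?I / ?m"] show ?thesis by (simp add: field_simps power2_eq_square)
  qed
  then have "?I \<le> sqrt (?m * (L2_norm S f)\<^sup>2)" by (rule real_le_rsqrt)
  also have "\<dots> = sqrt ?m * L2_norm S f"
    by (simp add: real_sqrt_mult L2_norm_nonneg)
  finally show ?thesis
    using integral_norm_bound[of "lebesgue_on S" f] by linarith
qed

text \<open>Turns the convergence of smooth approximants in the definition of a trace into
  convergence of integrals, both over a rectangle and over its edges.\<close>

lemma integral_tendsto_of_L2_norm: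
  assumes "\<And>n. f n \<in> L2 S" "g \<in> L2 S" "bounded S" "S \<in> sets lebesgue"
    and "(\<lambda>n. L2_norm S (\<lambda>z. f n z - g z)) \<longlonglongrightarrow> 0"
  shows "(\<lambda>n. LINT z|lebesgue_on S. f n z) \<longlonglongrightarrow> (LINT z|lebesgue_on S. g z)"
proof -
  have "(\<lambda>n. sqrt (measure lebesgue S) * L2_norm S (\<lambda>z. f n z - g z)) \<longlonglongrightarrow> 0"
    using tendsto_mult_left[OF assms(5)] by simp
  then have "(\<lambda>n. LINT z|lebesgue_on S. f n z - g z) \<longlonglongrightarrow> 0"
    by (rule Lim_null_comparison[rotated])
      (intro always_eventually allI norm_integral_le_L2_norm L2_diff assms(1-4))
  then have "(\<lambda>n. (LINT z|lebesgue_on S. f n z) - (LINT z|lebesgue_on S. g z)) \<longlonglongrightarrow> 0"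
    using L2_integrable[OF assms(1,3,4)] L2_integrable[OF assms(2-4)] by simp
  then show ?thesis by (rule Lim_null[THEN iffD2])
qed

subsection \<open>The fundamental lemma of the calculus of variations\<close>

text \<open>Boxes form an intersection-stable generator of the Borel sets, so a Dynkin argument
  extends the vanishing of the integral from boxes to all Borel sets. An integrable density whose
  integrals all vanish is zero almost everywhere.\<close>

lemma AE_eq_0_if_box_integrals_eq_0:
  fixes f :: "'a::euclidean_space \<Rightarrow> real"
  assumes int: "integrable lebesgue f"
    and box: "\<And>a b. (LINT z|lebesgue. indicator (box a b) z * f z) = 0"
  shows "AE z in lebesgue. f z = 0"
proof -
  \<comment> \<open>Boxes generate only the Borel sets, hence the passage to a Borel function that
    agrees with \<open>f\<close> almost everywhere.\<close>
  obtain g where g: "g \<in> borel_measurable lborel" "AE z in lborel. f z = g z"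
    using completion_ex_borel_measurable_real[of f lborel] int by auto
  then have fg: "AE z in lebesgue. f z = g z" by (simp add: AE_completion)
  have g_int: "integrable lborel g"
    using g(1) int fg integrable_cong_AE[of f lebesgue g]
    by (simp add: integrable_completion measurable_completion)
  then have setint: "set_integrable lborel A g" if "A \<in> sets borel" for A
    using that unfolding set_integrable_def by (intro integrable_mult_indicator) auto
  have box': "(LINT z:box a b|lborel. g z) = 0" for a b
  proof -
    have "(LINT z:box a b|lborel. g z) = (LINT z|lebesgue. indicator (box a b) z * g z)"
      using g(1) by (simp add: set_lebesgue_integral_def integral_completion)
    also have "\<dots> = (LINT z|lebesgue. indicator (box a b) z * f z)"
    proof (rule integral_cong_AE)
      show "(\<lambda>z. indicator (box a b) z * g z) \<in> borel_measurable lebesgue"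
        using g(1) by (intro borel_measurable_times borel_measurable_indicator)
          (auto simp: measurable_completion)
      show "(\<lambda>z. indicator (box a b) z * f z) \<in> borel_measurable lebesgue"
        using int by (intro borel_measurable_times borel_measurable_indicator borel_measurable_integrable) auto
    qed (use fg in auto)
    finally show ?thesis using box by simp
  qed
  \<comment> \<open>The integral over the whole space is needed for the complement case of the
    induction; it is the limit over an increasing sequence of boxes.\<close>
  have UN: "(\<Union>n::nat. box (- (real n *\<^sub>R One)) (real n *\<^sub>R One)) = (UNIV :: 'a set)"
    by (rule UN_box_eq_UNIV)
  have "incseq (\<lambda>n. box (- (real n *\<^sub>R One)) (real n *\<^sub>R One :: 'a))"
    by (intro incseq_SucI subset_box_imp) (auto simp: inner_simps)
  then have "(\<lambda>n. LINT z:box (- (real n *\<^sub>R One)) (real n *\<^sub>R One)|lborel. g z)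
      \<longlonglongrightarrow> (LINT z:(\<Union>n::nat. box (- (real n *\<^sub>R One)) (real n *\<^sub>R One))|lborel. g z)"
    using setint[of UNIV] by (intro set_integral_cont_up) (auto simp: UN)
  then have total: "(LINT z:UNIV|lborel. g z) = 0"
    using LIMSEQ_unique[OF tendsto_const] unfolding box' UN by metis
  have "(LINT z:A|lborel. g z) = 0" if "A \<in> sets lborel" for A
  proof -
    let ?G = "range (\<lambda>(a, b). box a b :: 'a set)"
    have "Int_stable ?G" by (auto simp: Int_stable_def box_Int_box)
    moreover have "?G \<subseteq> Pow UNIV" by simp
    moreover have "A \<in> sigma_sets UNIV ?G" using that by (simp add: borel_eq_box)
    ultimately show ?thesis
    proof (induction rule: sigma_sets_induct_disjoint)
      case (basic A)
      then show ?case using box' by auto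
    next
      case empty
      then show ?case by (simp add: set_lebesgue_integral_def)
    next
      case (compl A)
      then have A: "A \<in> sets borel" by (simp add: borel_eq_box)
      then have "(LINT z:A \<union> (UNIV - A)|lborel. g z) = (LINT z:A|lborel. g z) + (LINT z:UNIV - A|lborel. g z)"
        by (intro set_integral_Un setint) auto
      then show ?case using compl total by simp
    next
      case (union A)
      then have A: "A i \<in> sets borel" for i by (simp add: borel_eq_box image_subset_iff)
      then have "(LINT z:(\<Union>i. A i)|lborel. g z) = (\<Sum>i. LINT z:A i|lborel. g z)"
        using union(1) by (intro lebesgue_integral_countable_add setint) (auto simp: disjoint_family_on_def)
      then show ?case using union by simp
    qed
  qed
  then have "AE z in lborel. g z = 0"
    by (rule sigma_finite_measure.density_zero[OF lborel.sigma_finite_measure_axioms g_int])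
  then show ?thesis using g(2) by (intro AE_completion) auto
qed

text \<open>Cutoffs of a rectangle inside the domain are test functions that converge boundedly to
  its indicator, so dominated convergence reduces the claim to integrals over boxes.\<close>

lemma AE_eq_0_if_test_integrals_eq_0:
  assumes int: "integrable (lebesgue_on ({a<..<b} \<times> {c<..<d})) f"
    and test: "\<And>\<phi>. test_fun ({a<..<b} \<times> {c<..<d}) \<phi> \<Longrightarrow>
      (LINT z|lebesgue_on ({a<..<b} \<times> {c<..<d}). f z * \<phi> z) = 0"
  shows "AE z in lebesgue_on ({a<..<b} \<times> {c<..<d}). f z = 0"
proof -
  let ?K = "{a<..<b} \<times> {c<..<d}"
  have K: "?K \<in> sets lebesgue" by (simp add: open_Times borel_open)
  define g where "g = (\<lambda>z. indicator ?K z * f z)"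
  have g: "integrable lebesgue g"
    using int K by (simp add: integrable_restrict_space g_def)
  have "(LINT z|lebesgue. indicator (box p q) z * g z) = 0" for p q :: "real \<times> real"
  proof -
    \<comment> \<open>The intersection of the box with the rectangle is again a rectangle, possibly
      empty, and its cutoffs have compact support inside the original rectangle.\<close>
    define a' b' c' d' where "a' = max a (fst p)" "b' = min b (fst q)" "c' = max c (snd p)" "d' = min d (snd q)"
    note defs = this
    have box: "indicator (box p q) z * g z = indicator ({a'<..<b'} \<times> {c'<..<d'}) z * g z" for z
      unfolding g_def defs by (cases z; cases p; cases q) (auto simp: box_prod indicator_def)
    let ?\<phi> = "\<lambda>n. cutoff2 a' b' c' d' (Suc n)"
    have sub: "{a'<..<b'} \<times> {c'<..<d'} \<subseteq> ?K" by (auto simp: defs)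
    have test': "test_fun ?K (?\<phi> n)" for n
      using sub by (rule test_fun_cutoff2)
    have zero: "(LINT z|lebesgue. ?\<phi> n z * g z) = 0" for n
      using test[OF test'[of n]] K by (simp add: integral_restrict_space g_def mult_ac)
    have "(\<lambda>n. LINT z|lebesgue. ?\<phi> n z * g z)
      \<longlonglongrightarrow> (LINT z|lebesgue. indicator ({a'<..<b'} \<times> {c'<..<d'}) z * g z)"
    proof (rule integral_dominated_convergence[where w="\<lambda>z. norm (g z)"])
      have "?\<phi> n \<in> borel_measurable borel" for n
        using test'[of n] unfolding test_fun_def
        by (intro borel_measurable_continuous_onI smooth_fun_continuous) simp
      then show "(\<lambda>z. ?\<phi> n z * g z) \<in> borel_measurable lebesgue" for n
        using g by (intro borel_measurable_times) (auto intro: measurable_completion)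
      show "(\<lambda>z. indicator ({a'<..<b'} \<times> {c'<..<d'}) z * g z) \<in> borel_measurable lebesgue"
        using g by (intro borel_measurable_times borel_measurable_indicator)
          (auto simp: open_Times borel_open)
      show "AE z in lebesgue. (\<lambda>n. ?\<phi> n z * g z)
          \<longlonglongrightarrow> indicator ({a'<..<b'} \<times> {c'<..<d'}) z * g z"
        by (intro AE_I2 tendsto_mult cutoff2_tendsto_indicator tendsto_const)
      show "AE z in lebesgue. norm (?\<phi> n z * g z) \<le> norm (g z)" for n
        using cutoff2_bounds by (intro AE_I2) (simp add: abs_mult mult_left_le_one_le)
    qed (use g in simp)
    then show ?thesis unfolding zero box by (simp add: LIMSEQ_const_iff)
  qed
  with g have "AE z in lebesgue. g z = 0" by (rule AE_eq_0_if_box_integrals_eq_0)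
  then show ?thesis using K by (simp add: AE_restrict_space_iff g_def indicator_def)
qed

subsection \<open>Weak divergence on rectangles\<close>

lemma smooth_fun_grad:
  assumes "smooth_fun \<phi>"
  shows "(\<phi> has_derivative (\<lambda>w. w \<bullet> grad \<phi> z)) (at z)" "continuous_on UNIV (grad \<phi>)"
proof -
  obtain D where D: "D 0 0 = \<phi>" "\<And>m n z. (D m n has_derivative
      (\<lambda>w. fst w * D (Suc m) n z + snd w * D m (Suc n) z)) (at z)"
    using assms unfolding smooth_fun_def by blast
  have der: "(\<phi> has_derivative (\<lambda>w. fst w * D 1 0 z + snd w * D 0 1 z)) (at z)" for z
    using D(2)[of 0 0 z] D(1) by simp
  have grad: "grad \<phi> z = (D 1 0 z, D 0 1 z)" for z
    unfolding grad_def frechet_derivative_at[OF der, symmetric] by simp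
  show "(\<phi> has_derivative (\<lambda>w. w \<bullet> grad \<phi> z)) (at z)"
    using der by (simp add: grad inner_prod_def)
  have "isCont (D m n) z" for m n z
    using D(2) has_derivative_continuous by blast
  then show "continuous_on UNIV (grad \<phi>)"
    unfolding grad by (intro continuous_at_imp_continuous_on ballI continuous_Pair)
qed

lemma test_fun_smooth: "test_fun S \<phi> \<Longrightarrow> smooth_fun \<phi>"
  by (simp add: test_fun_def)

lemma test_fun_outside:
  assumes "test_fun S \<phi>" "z \<notin> S"
  shows "\<phi> z = 0" "grad \<phi> z = 0"
proof -
  obtain C where C: "compact C" "C \<subseteq> S" "\<And>z. z \<notin> C \<Longrightarrow> \<phi> z = 0"
    using assms(1) unfolding test_fun_def by blast
  show "\<phi> z = 0" using C assms(2) by blast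
  \<comment> \<open>Off the compact set \<open>C\<close> the function is zero on an open set, so its
    derivative vanishes there too.\<close>
  have "((\<lambda>_. 0) has_derivative (\<lambda>_. 0 :: real)) (at z)" by simp
  then have "(\<phi> has_derivative (\<lambda>_. 0)) (at z)"
    by (rule has_derivative_transform_within_open[of _ _ _ _ "- C"])
      (use C assms(2) compact_imp_closed[OF C(1)] in \<open>auto simp: open_Compl\<close>)
  then show "grad \<phi> z = 0"
    by (simp add: grad_def frechet_derivative_at[symmetric] zero_prod_def)
qed

text \<open>A test function on the smaller set is one on the larger set, and it vanishes with its
  gradient outside the smaller set. This localises the weak divergence to mesh cells.\<close>

lemma has_weak_div_subset:
  assumes div: "has_weak_div S \<tau> d" and TS: "T \<subseteq> S" "T \<in> sets lebesgue" "S \<in> sets lebesgue"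
  shows "has_weak_div T \<tau> d"
  unfolding has_weak_div_def
proof (intro allI impI)
  fix \<phi> assume \<phi>: "test_fun T \<phi>"
  then have "test_fun S \<phi>" using TS unfolding test_fun_def by blast
  then have "(LINT z|lebesgue_on S. \<tau> z \<bullet> grad \<phi> z) = - (LINT z|lebesgue_on S. d z * \<phi> z)"
    using div by (simp add: has_weak_div_def)
  moreover have "(LINT z|lebesgue_on S. \<tau> z \<bullet> grad \<phi> z) = (LINT z|lebesgue_on T. \<tau> z \<bullet> grad \<phi> z)"
    using test_fun_outside[OF \<phi>] TS
    by (subst integral_restrict[of T S, symmetric]) (auto intro!: Bochner_Integration.integral_cong)
  moreover have "(LINT z|lebesgue_on S. d z * \<phi> z) = (LINT z|lebesgue_on T. d z * \<phi> z)"
    using test_fun_outside[OF \<phi>] TS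
    by (subst integral_restrict[of T S, symmetric]) (auto intro!: Bochner_Integration.integral_cong)
  ultimately show "(LINT z|lebesgue_on T. \<tau> z \<bullet> grad \<phi> z) = - (LINT z|lebesgue_on T. d z * \<phi> z)"
    by simp
qed

lemma sets_lebesgue_rect: "{a<..<b} \<times> {c<..<d} \<in> sets (lebesgue :: (real \<times> real) measure)"
  by (simp add: open_Times borel_open)

lemma bounded_rect: "bounded ({a<..<b::real} \<times> {c<..<d::real})"
  using bounded_box[of "(a, c)" "(b, d)"] by (simp add: box_prod)

section \<open>The divergence theorem for smooth functions on a rectangle\<close>

lemma integral_rect:
  fixes f :: "real \<times> real \<Rightarrow> real"
  assumes "continuous_on UNIV f"
  shows "(LINT z|lebesgue_on ({a<..<b} \<times> {c<..<d}). f z) =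
    integral {a..b} (\<lambda>x. integral {c..d} (\<lambda>y. f (x, y)))"
proof -
  have "(LINT z|lebesgue_on ({a<..<b} \<times> {c<..<d}). f z) = integral ({a<..<b} \<times> {c<..<d}) f"
    using assms sets_lebesgue_rect bounded_rect
    by (intro lebesgue_integral_eq_integral L2_integrable L2_continuous)
  also have "\<dots> = integral (cbox (a, c) (b, d)) f"
    unfolding integral_open_interval[symmetric] by (simp add: box_prod)
  also have "\<dots> = integral {a..b} (\<lambda>x. integral {c..d} (\<lambda>y. f (x, y)))"
    using integral_prod_continuous[OF continuous_on_subset[OF assms subset_UNIV]] by simp
  finally show ?thesis .
qed

lemma integral_Icc:
  fixes f :: "real \<Rightarrow> real"
  assumes "continuous_on UNIV f"
  shows "(LINT s|lebesgue_on {a..b}. f s) = integral {a..b} f"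
  by (intro lebesgue_integral_eq_integral continuous_imp_integrable_real
      continuous_on_subset[OF assms]) auto

text \<open>Fubini followed by the fundamental theorem of calculus in \<open>x\<close>. The gradient
  is passed as a separate function \<open>g\<close> so that products with explicit derivatives can
  be inserted.\<close>

lemma integral_partial_x:
  fixes \<psi> :: "real \<times> real \<Rightarrow> real"
  assumes der: "\<And>z. (\<psi> has_derivative (\<lambda>w. w \<bullet> g z)) (at z)"
    and cont: "continuous_on UNIV g" and "a \<le> b"
  shows "(LINT z|lebesgue_on ({a<..<b} \<times> {c<..<d}). fst (g z)) =
    (LINT s|lebesgue_on {c..d}. \<psi> (b, s)) - (LINT s|lebesgue_on {c..d}. \<psi> (a, s))"
proof -
  have cont_\<psi>: "continuous_on UNIV \<psi>"
    using der has_derivative_continuous by (blast intro: continuous_at_imp_continuous_on)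
  have cont': "continuous_on UNIV (\<lambda>s. \<psi> (x, s))" for x
    by (intro continuous_on_compose2[OF cont_\<psi>] continuous_intros) auto
  have cont_fst: "continuous_on UNIV (\<lambda>z. fst (g z))"
    by (intro continuous_intros cont)
  have "((\<lambda>x. \<psi> (x, y)) has_vector_derivative fst (g (x, y))) (at x within {a..b})" for x y
  proof -
    have "((\<lambda>x. \<psi> (x, y)) has_derivative (\<lambda>w. (w, 0) \<bullet> g (x, y))) (at x within {a..b})"
      by (rule has_derivative_compose[OF _ der, where f="\<lambda>x. (x, y)"])
        (auto intro!: derivative_eq_intros)
    then show ?thesis by (simp add: has_vector_derivative_def inner_prod_def mult.commute)
  qed
  then have FTC: "integral {a..b} (\<lambda>x. fst (g (x, y))) = \<psi> (b, y) - \<psi> (a, y)" for y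
    using \<open>a \<le> b\<close> by (intro integral_unique fundamental_theorem_of_calculus)
  have "(LINT z|lebesgue_on ({a<..<b} \<times> {c<..<d}). fst (g z)) =
      integral {a..b} (\<lambda>x. integral {c..d} (\<lambda>y. fst (g (x, y))))"
    by (rule integral_rect[OF cont_fst])
  \<comment> \<open>The iterated integral has \<open>y\<close> innermost, so the order is exchanged
    before integrating in \<open>x\<close>; the analogue for \<open>y\<close> can integrate
    directly.\<close>
  also have "\<dots> = integral {c..d} (\<lambda>y. integral {a..b} (\<lambda>x. fst (g (x, y))))"
    using integral_swap_continuous[of a c b d "\<lambda>x y. fst (g (x, y))"]
      continuous_on_subset[OF cont_fst subset_UNIV] by (simp add: case_prod_beta')
  also have "\<dots> = integral {c..d} (\<lambda>y. \<psi> (b, y)) - integral {c..d} (\<lambda>y. \<psi> (a, y))"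
    unfolding FTC by (intro Henstock_Kurzweil_Integration.integral_diff integrable_continuous_real
        continuous_on_subset[OF cont'] subset_UNIV)
  finally show ?thesis by (simp add: integral_Icc cont')
qed

lemma integral_partial_y:
  fixes \<psi> :: "real \<times> real \<Rightarrow> real"
  assumes der: "\<And>z. (\<psi> has_derivative (\<lambda>w. w \<bullet> g z)) (at z)"
    and cont: "continuous_on UNIV g" and "c \<le> d"
  shows "(LINT z|lebesgue_on ({a<..<b} \<times> {c<..<d}). snd (g z)) =
    (LINT s|lebesgue_on {a..b}. \<psi> (s, d)) - (LINT s|lebesgue_on {a..b}. \<psi> (s, c))"
proof -
  have cont_\<psi>: "continuous_on UNIV \<psi>"
    using der has_derivative_continuous by (blast intro: continuous_at_imp_continuous_on)
  have cont': "continuous_on UNIV (\<lambda>s. \<psi> (s, y))" for y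
    by (intro continuous_on_compose2[OF cont_\<psi>] continuous_intros) auto
  have cont_snd: "continuous_on UNIV (\<lambda>z. snd (g z))"
    by (intro continuous_intros cont)
  have "((\<lambda>y. \<psi> (x, y)) has_vector_derivative snd (g (x, y))) (at y within {c..d})" for x y
  proof -
    have "((\<lambda>y. \<psi> (x, y)) has_derivative (\<lambda>w. (0, w) \<bullet> g (x, y))) (at y within {c..d})"
      by (rule has_derivative_compose[OF _ der, where f="\<lambda>y. (x, y)"])
        (auto intro!: derivative_eq_intros)
    then show ?thesis by (simp add: has_vector_derivative_def inner_prod_def mult.commute)
  qed
  then have FTC: "integral {c..d} (\<lambda>y. snd (g (x, y))) = \<psi> (x, d) - \<psi> (x, c)" for x
    using \<open>c \<le> d\<close> by (intro integral_unique fundamental_theorem_of_calculus)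
  have "(LINT z|lebesgue_on ({a<..<b} \<times> {c<..<d}). snd (g z)) =
      integral {a..b} (\<lambda>x. integral {c..d} (\<lambda>y. snd (g (x, y))))"
    by (rule integral_rect[OF cont_snd])
  also have "\<dots> = integral {a..b} (\<lambda>x. \<psi> (x, d)) - integral {a..b} (\<lambda>x. \<psi> (x, c))"
    unfolding FTC by (intro Henstock_Kurzweil_Integration.integral_diff integrable_continuous_real
        continuous_on_subset[OF cont'] subset_UNIV)
  finally show ?thesis by (simp add: integral_Icc cont')
qed

text \<open>The difference of the divergences annihilates every test function, so the fundamental
  lemma applies. The fields are compared only almost everywhere because membership in
  \<open>RT_space\<close> prescribes them only up to null sets.\<close>

lemma has_weak_div_unique:
  fixes a b c d :: real
  defines "K \<equiv> {a<..<b} \<times> {c<..<d}"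
  assumes div: "has_weak_div K \<tau> e" "has_weak_div K \<tau>' e'"
    and L2: "e \<in> L2 K" "e' \<in> L2 K" "\<tau> \<in> L2 K" "\<tau>' \<in> L2 K"
    and eq: "AE z in lebesgue_on K. \<tau> z = \<tau>' z"
  shows "AE z in lebesgue_on K. e z = e' z"
proof -
  have K: "bounded K" "K \<in> sets lebesgue"
    unfolding K_def by (rule bounded_rect sets_lebesgue_rect)+
  have "AE z in lebesgue_on K. e z - e' z = 0"
    unfolding K_def
  proof (rule AE_eq_0_if_test_integrals_eq_0; fold K_def)
    show "integrable (lebesgue_on K) (\<lambda>z. e z - e' z)"
      using K L2 by (intro L2_integrable L2_diff)
    fix \<phi> assume \<phi>: "test_fun K \<phi>"
    have L2_\<phi>: "\<phi> \<in> L2 K" "grad \<phi> \<in> L2 K"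
      using K smooth_fun_continuous smooth_fun_grad(2) test_fun_smooth[OF \<phi>]
      by (auto intro!: L2_continuous)
    have "(LINT z|lebesgue_on K. \<tau> z \<bullet> grad \<phi> z) = (LINT z|lebesgue_on K. \<tau>' z \<bullet> grad \<phi> z)"
      using L2 L2_\<phi> eq by (intro integral_cong_AE borel_measurable_integrable[OF L2_integrable_inner]) auto
    then have "(LINT z|lebesgue_on K. e z * \<phi> z) = (LINT z|lebesgue_on K. e' z * \<phi> z)"
      using div \<phi> by (simp add: has_weak_div_def)
    moreover have "(LINT z|lebesgue_on K. (e z - e' z) * \<phi> z) =
        (LINT z|lebesgue_on K. e z * \<phi> z) - (LINT z|lebesgue_on K. e' z * \<phi> z)"
      using L2_integrable_inner[OF L2(1) L2_\<phi>(1)] L2_integrable_inner[OF L2(2) L2_\<phi>(1)]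
      by (simp add: left_diff_distrib)
    ultimately show "(LINT z|lebesgue_on K. (e z - e' z) * \<phi> z) = 0" by simp
  qed
  then show ?thesis by eventually_elim simp
qed

section \<open>Divergences of affine fields and of fields with traces\<close>

lemma Qpoly_1_0: "p \<in> Qpoly 1 0 \<Longrightarrow> \<exists>r s. p = (\<lambda>z. r + s * fst z)"
  by (auto simp: Qpoly_def case_prod_beta')

lemma Qpoly_0_1: "p \<in> Qpoly 0 1 \<Longrightarrow> \<exists>r s. p = (\<lambda>z. r + s * snd z)"
  by (auto simp: Qpoly_def case_prod_beta')

text \<open>Integration by parts: each component times a test function is differentiated in its own
  variable, and the boundary terms vanish.\<close>

lemma has_weak_div_affine:
  assumes "a \<le> b" "c \<le> d"
  shows "has_weak_div ({a<..<b} \<times> {c<..<d}) (\<lambda>z. (r + s * fst z, r' + s' * snd z)) (\<lambda>_. s + s')"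
  unfolding has_weak_div_def
proof (intro allI impI)
  let ?K = "{a<..<b} \<times> {c<..<d}"
  fix \<phi> assume \<phi>: "test_fun ?K \<phi>"
  note sm = test_fun_smooth[OF \<phi>]
  note [continuous_intros] = smooth_fun_grad(2)[OF sm] smooth_fun_continuous[OF sm]
  have int: "integrable (lebesgue_on ?K) f" if "continuous_on UNIV f" for f :: "real \<times> real \<Rightarrow> real"
    using that bounded_rect sets_lebesgue_rect by (intro L2_integrable L2_continuous)
  define P where "P = (\<lambda>z :: real \<times> real. r + s * fst z)"
  define Q where "Q = (\<lambda>z :: real \<times> real. r' + s' * snd z)"
  have contPQ[continuous_intros]: "continuous_on UNIV P" "continuous_on UNIV Q"
    unfolding P_def Q_def by (intro continuous_intros)+
  \<comment> \<open>The four boundary lines do not meet the open rectangle, outside of which a test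
    function is zero.\<close>
  have bd: "\<phi> (x, y) = 0" if "x \<in> {a, b} \<or> y \<in> {c, d}" for x y
    using test_fun_outside(1)[OF \<phi>, of "(x, y)"] that by auto
  have "((\<lambda>z. P z * \<phi> z) has_derivative (\<lambda>w. w \<bullet> (P z *\<^sub>R grad \<phi> z + (s * \<phi> z, 0)))) (at z)" for z
    unfolding P_def
    by (rule derivative_eq_intros smooth_fun_grad(1)[OF sm] refl | simp add: inner_prod_def algebra_simps)+
  from integral_partial_x[OF this _ \<open>a \<le> b\<close>, of c d]
  have 1: "(LINT z|lebesgue_on ?K. P z * fst (grad \<phi> z) + s * \<phi> z) = 0"
    by (simp add: continuous_intros bd)
  have "((\<lambda>z. Q z * \<phi> z) has_derivative (\<lambda>w. w \<bullet> (Q z *\<^sub>R grad \<phi> z + (0, s' * \<phi> z)))) (at z)" for z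
    unfolding Q_def
    by (rule derivative_eq_intros smooth_fun_grad(1)[OF sm] refl | simp add: inner_prod_def algebra_simps)+
  from integral_partial_y[OF this _ \<open>c \<le> d\<close>, of a b]
  have 2: "(LINT z|lebesgue_on ?K. Q z * snd (grad \<phi> z) + s' * \<phi> z) = 0"
    by (simp add: continuous_intros bd)
  have "(LINT z|lebesgue_on ?K. (P z, Q z) \<bullet> grad \<phi> z) + (LINT z|lebesgue_on ?K. (s + s') * \<phi> z) =
      (LINT z|lebesgue_on ?K. (P z, Q z) \<bullet> grad \<phi> z + (s + s') * \<phi> z)"
    by (intro Bochner_Integration.integral_add[symmetric] int continuous_intros)
  also have "\<dots> = (LINT z|lebesgue_on ?K. (P z * fst (grad \<phi> z) + s * \<phi> z) + (Q z * snd (grad \<phi> z) + s' * \<phi> z))"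
    by (simp add: inner_prod_def algebra_simps)
  also have "\<dots> = 0"
    using 1 2 by (subst Bochner_Integration.integral_add) (auto intro!: int continuous_intros)
  finally show "(LINT z|lebesgue_on ?K. (r + s * fst z, r' + s' * snd z) \<bullet> grad \<phi> z) =
      - (LINT z|lebesgue_on ?K. (s + s') * \<phi> z)"
    by (simp add: P_def Q_def)
qed

text \<open>The two weak gradient identities are vector equations; the first component of one and
  the second component of the other add up to the weak divergence identity.\<close>

lemma has_weak_div_of_weak_grads:
  fixes a b c d :: real
  defines "K \<equiv> {a<..<b} \<times> {c<..<d}"
  assumes grad: "has_weak_grad K (\<lambda>z. fst (w z)) G" "has_weak_grad K (\<lambda>z. snd (w z)) H"
    and L2: "(\<lambda>z. fst (w z)) \<in> L2 K" "(\<lambda>z. snd (w z)) \<in> L2 K" "G \<in> L2 K" "H \<in> L2 K"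
  shows "has_weak_div K w (\<lambda>z. fst (G z) + snd (H z))"
  unfolding has_weak_div_def
proof (intro allI impI)
  have K: "bounded K" "K \<in> sets lebesgue"
    unfolding K_def by (rule bounded_rect sets_lebesgue_rect)+
  fix \<phi> assume \<phi>: "test_fun K \<phi>"
  have L2_\<phi>: "\<phi> \<in> L2 K" "grad \<phi> \<in> L2 K"
    using K smooth_fun_continuous smooth_fun_grad(2) test_fun_smooth[OF \<phi>]
    by (auto intro!: L2_continuous)
  note lin = L2_bounded_linear[OF bounded_linear_fst] L2_bounded_linear[OF bounded_linear_snd]
  \<comment> \<open>Integrability of the vector integrand justifies taking components of a Bochner
    integral.\<close>
  have int: "integrable (lebesgue_on K) (\<lambda>z. f z *\<^sub>R V z)"
    if "f \<in> L2 K" "V \<in> L2 K" for f and V :: "real \<times> real \<Rightarrow> real \<times> real"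
  proof -
    have "integrable (lebesgue_on K) (\<lambda>z. (f z * fst (V z)) *\<^sub>R (1, 0) + (f z * snd (V z)) *\<^sub>R (0, 1) :: real \<times> real)"
      using L2_integrable_inner[OF that(1) lin(1)[OF that(2)]] L2_integrable_inner[OF that(1) lin(2)[OF that(2)]]
      by (intro Bochner_Integration.integrable_add integrable_scaleR_left) simp_all
    then show ?thesis by (simp add: scaleR_prod_def)
  qed
  have 1: "(LINT z|lebesgue_on K. fst (w z) * fst (grad \<phi> z)) = - (LINT z|lebesgue_on K. \<phi> z * fst (G z))"
    using grad(1) \<phi> int[OF L2(1) L2_\<phi>(2)] int[OF L2_\<phi>(1) L2(3)]
    by (auto simp: has_weak_grad_def prod_eq_iff
        integral_bounded_linear[OF bounded_linear_fst, symmetric])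
  have 2: "(LINT z|lebesgue_on K. snd (w z) * snd (grad \<phi> z)) = - (LINT z|lebesgue_on K. \<phi> z * snd (H z))"
    using grad(2) \<phi> int[OF L2(2) L2_\<phi>(2)] int[OF L2_\<phi>(1) L2(4)]
    by (auto simp: has_weak_grad_def prod_eq_iff
        integral_bounded_linear[OF bounded_linear_snd, symmetric])
  have "(LINT z|lebesgue_on K. w z \<bullet> grad \<phi> z) =
      (LINT z|lebesgue_on K. fst (w z) * fst (grad \<phi> z)) + (LINT z|lebesgue_on K. snd (w z) * snd (grad \<phi> z))"
    using L2_integrable_inner[OF L2(1) lin(1)[OF L2_\<phi>(2)]] L2_integrable_inner[OF L2(2) lin(2)[OF L2_\<phi>(2)]]
    by (simp add: inner_prod_def)
  moreover have "(LINT z|lebesgue_on K. (fst (G z) + snd (H z)) * \<phi> z) =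
      (LINT z|lebesgue_on K. \<phi> z * fst (G z)) + (LINT z|lebesgue_on K. \<phi> z * snd (H z))"
    using L2_integrable_inner[OF L2_\<phi>(1) lin(1)[OF L2(3)]] L2_integrable_inner[OF L2_\<phi>(1) lin(2)[OF L2(4)]]
    by (simp add: algebra_simps)
  ultimately show "(LINT z|lebesgue_on K. w z \<bullet> grad \<phi> z) =
      - (LINT z|lebesgue_on K. (fst (G z) + snd (H z)) * \<phi> z)"
    using 1 2 by simp
qed

text \<open>The identities hold for the smooth approximants; \<open>L\<^sup>2\<close> convergence of
  their gradients and of their edge restrictions carries them to the limit. The gradient
  \<open>G\<close> is the one supplied by the definition of the trace.\<close>

lemma has_trace_divergence_theorem:
  assumes tr: "has_trace a b c d w t" and "a \<le> b" "c \<le> d"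
  obtains G where "w \<in> L2 ({a<..<b} \<times> {c<..<d})" "G \<in> L2 ({a<..<b} \<times> {c<..<d})"
    "has_weak_grad ({a<..<b} \<times> {c<..<d}) w G"
    "(LINT z|lebesgue_on ({a<..<b} \<times> {c<..<d}). fst (G z)) =
      (LINT s|lebesgue_on {c..d}. t (b, s)) - (LINT s|lebesgue_on {c..d}. t (a, s))"
    "(LINT z|lebesgue_on ({a<..<b} \<times> {c<..<d}). snd (G z)) =
      (LINT s|lebesgue_on {a..b}. t (s, d)) - (LINT s|lebesgue_on {a..b}. t (s, c))"
proof -
  let ?K = "{a<..<b} \<times> {c<..<d}"
  obtain G \<phi> where w: "w \<in> L2 ?K" and G: "G \<in> L2 ?K" "has_weak_grad ?K w G"
    and sm: "\<And>n::nat. smooth_fun (\<phi> n)"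
    and limG: "(\<lambda>n. L2_norm ?K (\<lambda>z. grad (\<phi> n) z - G z)) \<longlonglongrightarrow> 0"
    and vert: "\<And>x. x \<in> {a, b} \<Longrightarrow> (\<lambda>s. t (x, s)) \<in> L2 {c..d} \<and>
      (\<lambda>n. L2_norm {c..d} (\<lambda>s. \<phi> n (x, s) - t (x, s))) \<longlonglongrightarrow> 0"
    and horz: "\<And>y. y \<in> {c, d} \<Longrightarrow> (\<lambda>s. t (s, y)) \<in> L2 {a..b} \<and>
      (\<lambda>n. L2_norm {a..b} (\<lambda>s. \<phi> n (s, y) - t (s, y))) \<longlonglongrightarrow> 0"
    using tr unfolding has_trace_def Let_def by blast
  have cont: "continuous_on UNIV (\<lambda>s. \<phi> n (x, s))" "continuous_on UNIV (\<lambda>s. \<phi> n (s, y))" for n x y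
    by (intro continuous_on_compose2[OF smooth_fun_continuous[OF sm]] continuous_intros; simp)+
  have limV: "(\<lambda>n. LINT s|lebesgue_on {c..d}. \<phi> n (x, s)) \<longlonglongrightarrow> (LINT s|lebesgue_on {c..d}. t (x, s))"
    if "x \<in> {a, b}" for x
    using vert[OF that] by (intro integral_tendsto_of_L2_norm[OF L2_continuous[OF cont(1)]]) auto
  have limH: "(\<lambda>n. LINT s|lebesgue_on {a..b}. \<phi> n (s, y)) \<longlonglongrightarrow> (LINT s|lebesgue_on {a..b}. t (s, y))"
    if "y \<in> {c, d}" for y
    using horz[OF that] by (intro integral_tendsto_of_L2_norm[OF L2_continuous[OF cont(2)]]) auto
  have K: "bounded ?K" "?K \<in> sets lebesgue"
    by (rule bounded_rect sets_lebesgue_rect)+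
  have L2_grad: "grad (\<phi> n) \<in> L2 ?K" for n
    using K smooth_fun_grad(2)[OF sm] by (intro L2_continuous)
  have lim: "(\<lambda>n. LINT z|lebesgue_on ?K. grad (\<phi> n) z) \<longlonglongrightarrow> (LINT z|lebesgue_on ?K. G z)"
    by (intro integral_tendsto_of_L2_norm L2_grad G(1) K limG)
  have intG: "integrable (lebesgue_on ?K) G" "integrable (lebesgue_on ?K) (grad (\<phi> n))" for n
    using L2_integrable K L2_grad G(1) by blast+
  have "(\<lambda>n. LINT z|lebesgue_on ?K. fst (grad (\<phi> n) z)) \<longlonglongrightarrow> (LINT z|lebesgue_on ?K. fst (G z))"
    using tendsto_fst[OF lim] intG by (simp add: integral_bounded_linear[OF bounded_linear_fst])
  moreover have "(\<lambda>n. LINT z|lebesgue_on ?K. fst (grad (\<phi> n) z)) \<longlonglongrightarrow>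
      (LINT s|lebesgue_on {c..d}. t (b, s)) - (LINT s|lebesgue_on {c..d}. t (a, s))"
    unfolding integral_partial_x[OF smooth_fun_grad[OF sm] \<open>a \<le> b\<close>]
    by (intro tendsto_diff limV) auto
  ultimately have 1: "(LINT z|lebesgue_on ?K. fst (G z)) =
      (LINT s|lebesgue_on {c..d}. t (b, s)) - (LINT s|lebesgue_on {c..d}. t (a, s))"
    by (rule LIMSEQ_unique)
  have "(\<lambda>n. LINT z|lebesgue_on ?K. snd (grad (\<phi> n) z)) \<longlonglongrightarrow> (LINT z|lebesgue_on ?K. snd (G z))"
    using tendsto_snd[OF lim] intG by (simp add: integral_bounded_linear[OF bounded_linear_snd])
  moreover have "(\<lambda>n. LINT z|lebesgue_on ?K. snd (grad (\<phi> n) z)) \<longlonglongrightarrow>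
      (LINT s|lebesgue_on {a..b}. t (s, d)) - (LINT s|lebesgue_on {a..b}. t (s, c))"
    unfolding integral_partial_y[OF smooth_fun_grad[OF sm] \<open>c \<le> d\<close>]
    by (intro tendsto_diff limH) auto
  ultimately have 2: "(LINT z|lebesgue_on ?K. snd (G z)) =
      (LINT s|lebesgue_on {a..b}. t (s, d)) - (LINT s|lebesgue_on {a..b}. t (s, c))"
    by (rule LIMSEQ_unique)
  from that[OF w G 1 2] show thesis .
qed

text \<open>By the divergence theorem for traces the integral is a signed sum of the four edge
  fluxes, each of which vanishes.\<close>

lemma zero_edge_fluxes_integral_weak_div:
  fixes a b c d :: real
  defines "K \<equiv> {a<..<b} \<times> {c<..<d}"
  assumes flux: "zero_edge_fluxes a b c d w" and le: "a \<le> b" "c \<le> d"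
    and div: "has_weak_div K w e" "e \<in> L2 K" and w: "w \<in> L2 K"
  shows "(LINT z|lebesgue_on K. e z) = 0"
proof -
  have K: "bounded K" "K \<in> sets lebesgue"
    unfolding K_def by (rule bounded_rect sets_lebesgue_rect)+
  obtain t :: "real \<times> real \<Rightarrow> real \<times> real" where
    t: "has_trace a b c d (\<lambda>z. fst (w z)) (\<lambda>z. fst (t z))"
      "has_trace a b c d (\<lambda>z. snd (w z)) (\<lambda>z. snd (t z))"
    and zero: "\<And>x. x \<in> {a, b} \<Longrightarrow> (LINT s|lebesgue_on {c..d}. fst (t (x, s))) = 0"
      "\<And>y. y \<in> {c, d} \<Longrightarrow> (LINT s|lebesgue_on {a..b}. snd (t (s, y))) = 0"
    using flux unfolding zero_edge_fluxes_def by (auto simp: inner_prod_def)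
  obtain G where G: "(\<lambda>z. fst (w z)) \<in> L2 K" "G \<in> L2 K" "has_weak_grad K (\<lambda>z. fst (w z)) G"
    "(LINT z|lebesgue_on K. fst (G z)) =
      (LINT s|lebesgue_on {c..d}. fst (t (b, s))) - (LINT s|lebesgue_on {c..d}. fst (t (a, s)))"
    by (rule has_trace_divergence_theorem[OF t(1) le, folded K_def])
  obtain H where H: "(\<lambda>z. snd (w z)) \<in> L2 K" "H \<in> L2 K" "has_weak_grad K (\<lambda>z. snd (w z)) H"
    "(LINT z|lebesgue_on K. snd (H z)) =
      (LINT s|lebesgue_on {a..b}. snd (t (s, d))) - (LINT s|lebesgue_on {a..b}. snd (t (s, c)))"
    by (rule has_trace_divergence_theorem[OF t(2) le, folded K_def])
  have "has_weak_div K w (\<lambda>z. fst (G z) + snd (H z))"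
    using G H unfolding K_def by (intro has_weak_div_of_weak_grads)
  have L2_GH: "(\<lambda>z. fst (G z)) \<in> L2 K" "(\<lambda>z. snd (H z)) \<in> L2 K"
    using L2_bounded_linear bounded_linear_fst bounded_linear_snd G(2) H(2) by blast+
  \<comment> \<open>Uniqueness is applied with \<open>w\<close> as both fields: it identifies the
    given divergence with the one assembled from the gradients of the components.\<close>
  have "AE z in lebesgue_on K. e z = fst (G z) + snd (H z)"
    using div w L2_add[OF L2_GH] \<open>has_weak_div K w (\<lambda>z. fst (G z) + snd (H z))\<close>
    unfolding K_def by (intro has_weak_div_unique) auto
  then have "(LINT z|lebesgue_on K. e z) = (LINT z|lebesgue_on K. fst (G z) + snd (H z))"
    using L2_borel_measurable div(2) L2_add[OF L2_GH] by (intro integral_cong_AE)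
  also have "\<dots> = 0"
    using G(4) H(4) zero L2_integrable[OF L2_GH(1) K] L2_integrable[OF L2_GH(2) K] by simp
  finally show ?thesis .
qed

subsection \<open>Integration over the mesh\<close>

text \<open>A mesh guarantees only that the interiors of the elements lie in the domain; the open
  cells are moreover disjoint, and weak derivatives are formulated on open rectangles.\<close>

definition open_cell :: "grid \<Rightarrow> nat \<Rightarrow> nat \<Rightarrow> (real \<times> real) set" where
  "open_cell M i j = {gx M i <..< gx M (Suc i)} \<times> {gy M j <..< gy M (Suc j)}"

lemma open_cell_subset_cell: "open_cell M i j \<subseteq> cell M i j"
  by (auto simp: open_cell_def cell_def)

lemma interior_cell: "interior (cell M i j) = open_cell M i j"
  by (simp add: open_cell_def cell_def interior_Times)

lemma null_sets_cell_diff: "cell M i j - open_cell M i j \<in> null_sets lebesgue"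
  using negligible_frontier_interval[of "(gx M i, gy M j)" "(gx M (Suc i), gy M (Suc j))"]
  by (simp add: negligible_iff_null_sets box_prod cbox_Pair_eq open_cell_def cell_def)

lemma open_cell_lebesgue: "bounded (open_cell M i j)" "open_cell M i j \<in> sets lebesgue"
  unfolding open_cell_def by (rule bounded_rect sets_lebesgue_rect)+

lemma cell_lebesgue: "cell M i j \<in> sets lebesgue"
  by (simp add: cell_def closed_Times borel_closed)

text \<open>The boundary of a cell is a null set, so conditions imposed on closed elements can be
  used on open cells and conversely.\<close>

lemma AE_cell_iff: "(AE z in lebesgue_on (cell M i j). P z) \<longleftrightarrow> (AE z in lebesgue_on (open_cell M i j). P z)"
proof -
  have "AE z in lebesgue. z \<in> cell M i j \<longleftrightarrow> z \<in> open_cell M i j"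
    using AE_not_in[OF null_sets_cell_diff[of M i j]] open_cell_subset_cell[of M i j] by auto
  then have "(AE z in lebesgue. z \<in> cell M i j \<longrightarrow> P z) \<longleftrightarrow> (AE z in lebesgue. z \<in> open_cell M i j \<longrightarrow> P z)"
    by (intro eventually_cong) auto
  then show ?thesis by (simp add: AE_restrict_space_iff cell_lebesgue open_cell_lebesgue)
qed

lemma finite_elems: "finite (elems \<Omega> M)"
  by (rule finite_subset[of _ "{..<nx M} \<times> {..<ny M}"]) (auto simp: elems_def)

lemma mesh_strict_mono:
  assumes "is_mesh \<Omega> M"
  shows "strict_mono_on {..nx M} (gx M)" "strict_mono_on {..ny M} (gy M)"
  using assms by (simp_all only: is_mesh_def)

lemma elems_less: "(i, j) \<in> elems \<Omega> M \<Longrightarrow> i < nx M \<and> j < ny M"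
  by (simp add: elems_def)

lemma elems_le:
  assumes "is_mesh \<Omega> M" "(i, j) \<in> elems \<Omega> M"
  shows "gx M i \<le> gx M (Suc i)" "gy M j \<le> gy M (Suc j)"
  using strict_mono_onD[OF mesh_strict_mono(1)[OF assms(1)], of i "Suc i"]
    strict_mono_onD[OF mesh_strict_mono(2)[OF assms(1)], of j "Suc j"] elems_less[OF assms(2)]
  by simp_all

lemma open_cell_subset:
  assumes "is_mesh \<Omega> M" "(i, j) \<in> elems \<Omega> M"
  shows "open_cell M i j \<subseteq> \<Omega>"
  using assms unfolding is_mesh_def interior_cell by blast

lemma strict_mono_on_Ioo_disjoint:
  fixes g :: "nat \<Rightarrow> real"
  assumes "strict_mono_on {..n} g" "i < n" "j < n" "i \<noteq> j"
  shows "{g i <..< g (Suc i)} \<inter> {g j <..< g (Suc j)} = {}"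
proof -
  have "g (Suc k) \<le> g l" if "k < l" "l < n" for k l
    using that strict_mono_onD[OF assms(1), of "Suc k" l] by (cases "Suc k = l") auto
  from this[of i j] this[of j i] show ?thesis using assms(2-4) by (cases "i < j") auto
qed

lemma disjoint_open_cells:
  assumes "is_mesh \<Omega> M"
  shows "disjoint_family_on (\<lambda>p. open_cell M (fst p) (snd p)) (elems \<Omega> M)"
  unfolding disjoint_family_on_def
proof (intro ballI impI)
  fix p q assume "p \<in> elems \<Omega> M" "q \<in> elems \<Omega> M" "p \<noteq> q"
  moreover from this have "fst p \<noteq> fst q \<or> snd p \<noteq> snd q" by (simp add: prod_eq_iff)
  ultimately have "{gx M (fst p) <..< gx M (Suc (fst p))} \<inter> {gx M (fst q) <..< gx M (Suc (fst q))} = {} \<or>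
      {gy M (snd p) <..< gy M (Suc (snd p))} \<inter> {gy M (snd q) <..< gy M (Suc (snd q))} = {}"
    using strict_mono_on_Ioo_disjoint mesh_strict_mono[OF assms] elems_less prod.collapse by metis
  then show "open_cell M (fst p) (snd p) \<inter> open_cell M (fst q) (snd q) = {}"
    unfolding open_cell_def Times_Int_Times by blast
qed

text \<open>The domain is squeezed between the union of the open cells and that of the closed cells,
  which differ by finitely many null sets.\<close>

lemma AE_mesh:
  assumes "is_mesh \<Omega> M"
  shows "AE z in lebesgue. z \<in> \<Omega> \<longleftrightarrow> z \<in> (\<Union>(i, j) \<in> elems \<Omega> M. open_cell M i j)"
proof -
  have "(\<Union>p \<in> elems \<Omega> M. cell M (fst p) (snd p) - open_cell M (fst p) (snd p)) \<in> null_sets lebesgue"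
    using finite_elems by (intro null_sets_UN' countable_finite null_sets_cell_diff)
  moreover have "\<Omega> \<subseteq> (\<Union>(i, j) \<in> elems \<Omega> M. cell M i j)"
    using assms closure_subset[of \<Omega>] by (simp add: is_mesh_def)
  ultimately show ?thesis
    using open_cell_subset[OF assms] by (intro AE_I') fastforce+
qed

lemma integral_mesh:
  fixes f :: "real \<times> real \<Rightarrow> real"
  assumes mesh: "is_mesh \<Omega> M" and \<Omega>: "\<Omega> \<in> sets lebesgue" and int: "integrable (lebesgue_on \<Omega>) f"
  shows "(LINT z|lebesgue_on \<Omega>. f z) = (\<Sum>(i, j) \<in> elems \<Omega> M. LINT z|lebesgue_on (open_cell M i j). f z)"
proof -
  let ?A = "\<lambda>p. open_cell M (fst p) (snd p)"
  have f: "set_integrable lebesgue \<Omega> f"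
    using int \<Omega> by (simp add: set_integrable_def integrable_restrict_space)
  have f': "set_integrable lebesgue (?A p) f" if "p \<in> elems \<Omega> M" for p
    using f open_cell_lebesgue open_cell_subset[OF mesh, of "fst p" "snd p"] that
    by (auto intro: set_integrable_subset)
  have UN: "set_integrable lebesgue (\<Union>p\<in>elems \<Omega> M. ?A p) f"
    using f' finite_elems open_cell_lebesgue by (intro set_integrable_UN)
  have "(LINT z:\<Omega>|lebesgue. f z) = (LINT z:(\<Union>p\<in>elems \<Omega> M. ?A p)|lebesgue. f z)"
  proof (rule set_integral_cong_set)
    show "set_borel_measurable lebesgue (\<Union>p\<in>elems \<Omega> M. ?A p) f" "set_borel_measurable lebesgue \<Omega> f"
      using UN f by (auto simp: set_borel_measurable_def set_integrable_def)
    show "AE z in lebesgue. z \<in> (\<Union>p\<in>elems \<Omega> M. ?A p) \<longleftrightarrow> z \<in> \<Omega>"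
      using AE_mesh[OF mesh] by (simp add: case_prod_beta' eq_commute)
  qed
  also have "\<dots> = (\<Sum>p\<in>elems \<Omega> M. LINT z:?A p|lebesgue. f z)"
    using disjoint_open_cells[OF mesh] f' open_cell_lebesgue finite_elems
    by (intro set_integral_finite_Union) auto
  finally show ?thesis
    using \<Omega> open_cell_lebesgue
    by (simp add: integral_restrict_space set_lebesgue_integral_def case_prod_beta')
qed

subsection \<open>Raviart--Thomas elements and the error identity\<close>

lemma wdiv_Hdiv:
  assumes "\<tau> \<in> Hdiv \<Omega>"
  shows "wdiv \<Omega> \<tau> \<in> L2 \<Omega>" "has_weak_div \<Omega> \<tau> (wdiv \<Omega> \<tau>)"
proof -
  have "\<exists>d. d \<in> L2 \<Omega> \<and> has_weak_div \<Omega> \<tau> d" using assms by (auto simp: Hdiv_def)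
  from someI_ex[OF this] show "wdiv \<Omega> \<tau> \<in> L2 \<Omega>" "has_weak_div \<Omega> \<tau> (wdiv \<Omega> \<tau>)"
    by (auto simp: wdiv_def)
qed

lemma Hdiv_L2: "\<tau> \<in> Hdiv \<Omega> \<Longrightarrow> \<tau> \<in> L2 \<Omega>"
  by (simp add: Hdiv_def)

lemma RT_Hdiv: "\<tau> \<in> RT_space \<Omega> M \<Longrightarrow> \<tau> \<in> Hdiv \<Omega>"
  by (simp add: RT_space_def)

lemma P0_L2: "v \<in> P0_space \<Omega> M \<Longrightarrow> v \<in> L2 \<Omega>"
  by (simp add: P0_space_def)

lemma P0_cell:
  assumes "v \<in> P0_space \<Omega> M" "(i, j) \<in> elems \<Omega> M"
  obtains c where "AE z in lebesgue_on (cell M i j). v z = c"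
  using assms unfolding P0_space_def by blast

lemma P0_diff_scale:
  assumes "v \<in> P0_space \<Omega> M" "w \<in> P0_space \<Omega> M"
  shows "(\<lambda>z. v z - r * w z) \<in> P0_space \<Omega> M"
proof -
  have "\<exists>c. AE z in lebesgue_on (cell M i j). v z - r * w z = c" if "(i, j) \<in> elems \<Omega> M" for i j
  proof -
    obtain c c' where "AE z in lebesgue_on (cell M i j). v z = c" "AE z in lebesgue_on (cell M i j). w z = c'"
      using P0_cell assms \<open>(i, j) \<in> elems \<Omega> M\<close> by metis
    then have "AE z in lebesgue_on (cell M i j). v z - r * w z = c - r * c'"
      by eventually_elim simp
    then show ?thesis by blast
  qed
  then show ?thesis using assms by (auto simp: P0_space_def intro!: L2_diff L2_scale)
qed

text \<open>On each cell the field is affine with constant divergence, and uniqueness transfers this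
  to the chosen representative \<open>wdiv\<close>. Hence the divergence itself is admissible as a
  discrete test function.\<close>

lemma wdiv_RT_in_P0:
  assumes mesh: "is_mesh \<Omega> M" and \<Omega>: "\<Omega> \<in> sets lebesgue" and \<tau>: "\<tau> \<in> RT_space \<Omega> M"
  shows "wdiv \<Omega> \<tau> \<in> P0_space \<Omega> M"
proof -
  have "\<exists>c. AE z in lebesgue_on (cell M i j). wdiv \<Omega> \<tau> z = c" if ij: "(i, j) \<in> elems \<Omega> M" for i j
  proof -
    let ?K = "open_cell M i j"
    note sub = open_cell_subset[OF mesh ij] open_cell_lebesgue
    obtain p q where pq: "p \<in> Qpoly 1 0" "q \<in> Qpoly 0 1"
      and eq: "AE z in lebesgue_on ?K. \<tau> z = (p z, q z)"
      using \<tau> ij by (auto simp: RT_space_def AE_cell_iff)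
    obtain r s r' s' where rs: "p = (\<lambda>z. r + s * fst z)" "q = (\<lambda>z. r' + s' * snd z)"
      using Qpoly_1_0[OF pq(1)] Qpoly_0_1[OF pq(2)] by blast
    have "AE z in lebesgue_on ?K. wdiv \<Omega> \<tau> z = s + s'"
      unfolding open_cell_def
    proof (rule has_weak_div_unique; (fold open_cell_def)?)
      show "has_weak_div ?K \<tau> (wdiv \<Omega> \<tau>)"
        by (rule has_weak_div_subset[OF wdiv_Hdiv(2)[OF RT_Hdiv[OF \<tau>]] sub(1,3) \<Omega>])
      show "has_weak_div ?K (\<lambda>z. (r + s * fst z, r' + s' * snd z)) (\<lambda>_. s + s')"
        unfolding open_cell_def using elems_le[OF mesh ij] by (intro has_weak_div_affine)
      show "wdiv \<Omega> \<tau> \<in> L2 ?K" "\<tau> \<in> L2 ?K"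
        using L2_subset[OF wdiv_Hdiv(1)[OF RT_Hdiv[OF \<tau>]] sub(1) \<Omega> sub(3)]
          L2_subset[OF Hdiv_L2[OF RT_Hdiv[OF \<tau>]] sub(1) \<Omega> sub(3)] .
      show "(\<lambda>_. s + s') \<in> L2 ?K" "(\<lambda>z. (r + s * fst z, r' + s' * snd z)) \<in> L2 ?K"
        by (intro L2_continuous continuous_intros open_cell_lebesgue)+
      show "AE z in lebesgue_on ?K. \<tau> z = (r + s * fst z, r' + s' * snd z)"
        using eq by (simp add: rs)
    qed
    then show ?thesis by (auto simp: AE_cell_iff)
  qed
  then show ?thesis using wdiv_Hdiv(1)[OF RT_Hdiv[OF \<tau>]] by (auto simp: P0_space_def)
qed

section \<open>Commuting property of the interpolation and comparison of the two
  eigenproblems\<close>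

lemma L2_inner_diff_left:
  assumes "f \<in> L2 S" "g \<in> L2 S" "v \<in> L2 S"
  shows "L2_inner S (\<lambda>z. f z - g z) v = L2_inner S f v - L2_inner S g v"
  using L2_integrable_inner[OF assms(1,3)] L2_integrable_inner[OF assms(2,3)]
  by (simp add: L2_inner_def inner_diff_left)

lemma L2_inner_commute: "L2_inner S f g = L2_inner S g f"
  by (simp add: L2_inner_def inner_commute)

text \<open>The commuting property: the interpolation error has zero edge fluxes, so its divergence
  has mean zero on every element, where \<open>v\<close> is constant.\<close>

lemma RT_interp_wdiv:
  assumes mesh: "is_mesh \<Omega> M" and \<Omega>: "\<Omega> \<in> sets lebesgue" and \<sigma>: "\<sigma> \<in> Hdiv \<Omega>"
    and interp: "is_RT_interp \<Omega> M \<sigma> \<sigma>I" and v: "v \<in> P0_space \<Omega> M"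
  shows "L2_inner \<Omega> (wdiv \<Omega> \<sigma>I) v = L2_inner \<Omega> (wdiv \<Omega> \<sigma>) v"
proof -
  have \<sigma>I: "\<sigma>I \<in> Hdiv \<Omega>"
    using interp RT_Hdiv by (auto simp: is_RT_interp_def)
  note d = wdiv_Hdiv[OF \<sigma>] wdiv_Hdiv[OF \<sigma>I]
  define e where "e = (\<lambda>z. wdiv \<Omega> \<sigma> z - wdiv \<Omega> \<sigma>I z)"
  have e: "e \<in> L2 \<Omega>" unfolding e_def using d by (intro L2_diff)
  have zero: "(LINT z|lebesgue_on (open_cell M i j). e z * v z) = 0" if ij: "(i, j) \<in> elems \<Omega> M" for i j
  proof -
    let ?K = "open_cell M i j"
    note sub = open_cell_subset[OF mesh ij]
    have L2: "e \<in> L2 ?K" "v \<in> L2 ?K" "\<sigma> \<in> L2 ?K" "\<sigma>I \<in> L2 ?K" "wdiv \<Omega> \<sigma> \<in> L2 ?K" "wdiv \<Omega> \<sigma>I \<in> L2 ?K"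
      by (rule L2_subset[OF _ sub \<Omega> open_cell_lebesgue(2)],
          rule e P0_L2[OF v] Hdiv_L2[OF \<sigma>] Hdiv_L2[OF \<sigma>I] d(1,3))+
    have "has_weak_div ?K \<sigma> (wdiv \<Omega> \<sigma>)" "has_weak_div ?K \<sigma>I (wdiv \<Omega> \<sigma>I)"
      by (rule has_weak_div_subset[OF _ sub open_cell_lebesgue(2) \<Omega>], rule d(2,4))+
    then have div: "has_weak_div ?K (\<lambda>z. \<sigma> z - \<sigma>I z) e"
      unfolding has_weak_div_def
    proof (intro allI impI)
      fix \<phi> assume div: "\<forall>\<phi>. test_fun ?K \<phi> \<longrightarrow> (LINT z|lebesgue_on ?K. \<sigma> z \<bullet> grad \<phi> z) =
            - (LINT z|lebesgue_on ?K. wdiv \<Omega> \<sigma> z * \<phi> z)"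
          "\<forall>\<phi>. test_fun ?K \<phi> \<longrightarrow> (LINT z|lebesgue_on ?K. \<sigma>I z \<bullet> grad \<phi> z) =
            - (LINT z|lebesgue_on ?K. wdiv \<Omega> \<sigma>I z * \<phi> z)"
        and \<phi>: "test_fun ?K \<phi>"
      \<comment> \<open>Square integrability of the test function and its gradient lets the
        integrals of differences split.\<close>
      have "\<phi> \<in> L2 ?K" "grad \<phi> \<in> L2 ?K"
        using open_cell_lebesgue smooth_fun_continuous smooth_fun_grad(2) test_fun_smooth[OF \<phi>]
        by (auto intro!: L2_continuous)
      then show "(LINT z|lebesgue_on ?K. (\<sigma> z - \<sigma>I z) \<bullet> grad \<phi> z) = - (LINT z|lebesgue_on ?K. e z * \<phi> z)"
        using div \<phi> L2 L2_inner_diff_left[of \<sigma> ?K \<sigma>I "grad \<phi>"]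
          L2_inner_diff_left[of "wdiv \<Omega> \<sigma>" ?K "wdiv \<Omega> \<sigma>I" \<phi>]
        by (simp add: L2_inner_def e_def)
    qed
    have flux: "zero_edge_fluxes (gx M i) (gx M (Suc i)) (gy M j) (gy M (Suc j)) (\<lambda>z. \<sigma> z - \<sigma>I z)"
      using interp ij by (auto simp: is_RT_interp_def)
    have int0: "(LINT z|lebesgue_on ?K. e z) = 0"
      unfolding open_cell_def
      by (rule zero_edge_fluxes_integral_weak_div[OF flux elems_le[OF mesh ij]]; fold open_cell_def)
        (use div L2 in \<open>auto intro: L2_diff\<close>)
    obtain c where c: "AE z in lebesgue_on ?K. v z = c"
      using P0_cell[OF v ij] unfolding AE_cell_iff .
    have "(LINT z|lebesgue_on ?K. e z * v z) = (LINT z|lebesgue_on ?K. e z * c)"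
      using c L2 by (intro integral_cong_AE borel_measurable_times borel_measurable_const L2_borel_measurable) auto
    then show ?thesis using int0 by simp
  qed
  have "L2_inner \<Omega> e v = 0"
    using integral_mesh[OF mesh \<Omega> L2_integrable_inner[OF e P0_L2[OF v]]] zero
    by (simp add: L2_inner_def case_prod_beta')
  then show ?thesis
    using L2_inner_diff_left[OF d(1,3) P0_L2[OF v]] by (simp add: e_def)
qed

text \<open>The residual of the second discrete equation lies in \<open>P0_space\<close>, so it may
  be tested with itself and has norm zero. The discrete equation thus holds pointwise almost
  everywhere and can be paired with the continuous \<open>u\<close>, which need not be piecewise
  constant.\<close>

lemma discrete_wdiv_eq:
  assumes mesh: "is_mesh \<Omega> M" and \<Omega>: "\<Omega> \<in> sets lebesgue"
    and sol: "mixed_solution \<Omega> (RT_space \<Omega> M) (P0_space \<Omega> M) \<mu> \<sigma> v"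
  shows "AE z in lebesgue_on \<Omega>. wdiv \<Omega> \<sigma> z = \<mu> * v z"
proof -
  have \<sigma>: "\<sigma> \<in> RT_space \<Omega> M" and v: "v \<in> P0_space \<Omega> M"
    and eq: "\<And>w. w \<in> P0_space \<Omega> M \<Longrightarrow> L2_inner \<Omega> (wdiv \<Omega> \<sigma>) w = \<mu> * L2_inner \<Omega> v w"
    using sol by (auto simp: mixed_solution_def)
  define w where "w = (\<lambda>z. wdiv \<Omega> \<sigma> z - \<mu> * v z)"
  have w: "w \<in> P0_space \<Omega> M"
    unfolding w_def by (rule P0_diff_scale[OF wdiv_RT_in_P0[OF mesh \<Omega> \<sigma>] v])
  have "L2_inner \<Omega> w w = L2_inner \<Omega> (wdiv \<Omega> \<sigma>) w - L2_inner \<Omega> (\<lambda>z. \<mu> * v z) w"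
    using L2_inner_diff_left[OF wdiv_Hdiv(1)[OF RT_Hdiv[OF \<sigma>]] L2_scale[OF P0_L2[OF v]] P0_L2[OF w]]
    by (simp add: w_def)
  also have "\<dots> = 0" using eq[OF w] by (simp add: L2_inner_def mult.assoc)
  finally have "(LINT z|lebesgue_on \<Omega>. w z * w z) = 0" by (simp add: L2_inner_def)
  then have "AE z in lebesgue_on \<Omega>. w z * w z = 0"
    using L2_integrable_inner[OF P0_L2[OF w] P0_L2[OF w]]
    by (subst (asm) integral_nonneg_eq_0_iff_AE) auto
  then show ?thesis by eventually_elim (simp add: w_def)
qed

text \<open>The identity is exact on each single mesh: the left side equals
  \<open>(\<mu>h - \<mu>) * (1 - (u, uh))\<close>, and the normalisation of both eigenfunctions
  turns the second factor into half of the squared error.\<close>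

lemma eigenvalue_error_identity:
  assumes mesh: "is_mesh \<Omega> M" and \<Omega>: "\<Omega> \<in> sets lebesgue"
    and cont: "mixed_solution \<Omega> (Hdiv \<Omega>) (L2 \<Omega>) \<mu> \<sigma> u"
    and disc: "mixed_solution \<Omega> (RT_space \<Omega> M) (P0_space \<Omega> M) \<mu>h \<sigma>h uh"
    and interp: "is_RT_interp \<Omega> M \<sigma> \<sigma>I"
    and norm: "L2_norm \<Omega> u = 1" "L2_inner \<Omega> uh uh = 1"
  shows "\<mu>h - \<mu> - L2_inner \<Omega> (\<lambda>z. \<sigma> z - \<sigma>I z) \<sigma>h =
    1 / 2 * (\<mu>h - \<mu>) * (L2_norm \<Omega> (\<lambda>z. uh z - u z))\<^sup>2"
proof -
  have \<sigma>: "\<sigma> \<in> Hdiv \<Omega>" and u: "u \<in> L2 \<Omega>"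
    and c1: "\<And>\<tau>. \<tau> \<in> Hdiv \<Omega> \<Longrightarrow> L2_inner \<Omega> \<sigma> \<tau> = L2_inner \<Omega> (wdiv \<Omega> \<tau>) u"
    and c2: "\<And>v. v \<in> L2 \<Omega> \<Longrightarrow> L2_inner \<Omega> (wdiv \<Omega> \<sigma>) v = \<mu> * L2_inner \<Omega> u v"
    using cont by (auto simp: mixed_solution_def)
  have \<sigma>h: "\<sigma>h \<in> RT_space \<Omega> M" and uh: "uh \<in> P0_space \<Omega> M"
    and d1: "\<And>\<tau>. \<tau> \<in> RT_space \<Omega> M \<Longrightarrow> L2_inner \<Omega> \<sigma>h \<tau> = L2_inner \<Omega> (wdiv \<Omega> \<tau>) uh"
    using disc by (auto simp: mixed_solution_def)
  have \<sigma>I: "\<sigma>I \<in> RT_space \<Omega> M" using interp by (simp add: is_RT_interp_def)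
  note L2 = u P0_L2[OF uh] Hdiv_L2[OF \<sigma>] Hdiv_L2[OF RT_Hdiv[OF \<sigma>h]] Hdiv_L2[OF RT_Hdiv[OF \<sigma>I]]
  \<comment> \<open>The method is conforming: \<open>\<sigma>h\<close> lies in \<open>Hdiv\<close>
    and may be inserted into the continuous problem.\<close>
  have "L2_inner \<Omega> \<sigma> \<sigma>h = L2_inner \<Omega> (wdiv \<Omega> \<sigma>h) u"
    using c1[OF RT_Hdiv[OF \<sigma>h]] .
  also have "\<dots> = L2_inner \<Omega> (\<lambda>z. \<mu>h * uh z) u"
    unfolding L2_inner_def using discrete_wdiv_eq[OF mesh \<Omega> disc] L2 wdiv_Hdiv(1)[OF RT_Hdiv[OF \<sigma>h]]
    by (intro integral_cong_AE borel_measurable_inner L2_borel_measurable L2_scale) auto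
  also have "\<dots> = \<mu>h * L2_inner \<Omega> u uh"
    by (subst L2_inner_commute) (simp add: L2_inner_def mult.left_commute)
  finally have 1: "L2_inner \<Omega> \<sigma> \<sigma>h = \<mu>h * L2_inner \<Omega> u uh" .
  \<comment> \<open>Three facts are chained: the first discrete equation tested with
    \<open>\<sigma>I\<close>, the commuting property for \<open>uh\<close>, and the second
    continuous equation tested with \<open>uh\<close>.\<close>
  have 2: "L2_inner \<Omega> \<sigma>I \<sigma>h = \<mu> * L2_inner \<Omega> u uh"
    using d1[OF \<sigma>I] RT_interp_wdiv[OF mesh \<Omega> \<sigma> interp uh] c2[OF L2(2)] by (simp add: L2_inner_commute)
  have "(L2_norm \<Omega> (\<lambda>z. uh z - u z))\<^sup>2 = L2_inner \<Omega> uh (\<lambda>z. uh z - u z) - L2_inner \<Omega> u (\<lambda>z. uh z - u z)"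
    using L2_inner_diff_left[OF L2(2,1) L2_diff[OF L2(2,1)]] by (simp add: L2_norm_power2)
  also have "\<dots> = 2 - 2 * L2_inner \<Omega> u uh"
    using L2_inner_diff_left[OF L2(2,1,2)] L2_inner_diff_left[OF L2(2,1,1)] norm L2_norm_power2[of \<Omega> u]
    by (simp add: L2_inner_commute[of \<Omega> _ "\<lambda>z. uh z - u z"] L2_inner_commute[of \<Omega> uh u])
  finally have 3: "(L2_norm \<Omega> (\<lambda>z. uh z - u z))\<^sup>2 = 2 - 2 * L2_inner \<Omega> u uh" .
  show ?thesis
    unfolding L2_inner_diff_left[OF L2(3,5,4)] 1 2 3 by (simp add: field_simps)
qed

text \<open>The limit of vanishing mesh size is taken along an arbitrary filter \<open>F\<close> on
  an index type of meshes. The pair \<open>\<sigma> i\<close>, \<open>u i\<close> carries the index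
  because for a multiple eigenvalue the matching eigenfunction may change with the mesh.\<close>

theorem theorem3:
  fixes \<Omega> :: "(real \<times> real) set"
    and F :: "'i filter"
    and M :: "'i \<Rightarrow> grid"
    and lam :: "nat \<Rightarrow> real"
    and sig :: "nat \<Rightarrow> real \<times> real \<Rightarrow> real \<times> real"
    and us :: "nat \<Rightarrow> real \<times> real \<Rightarrow> real"
    and N :: "'i \<Rightarrow> nat"
    and lamh :: "'i \<Rightarrow> nat \<Rightarrow> real"
    and sigh :: "'i \<Rightarrow> nat \<Rightarrow> real \<times> real \<Rightarrow> real \<times> real"
    and uh :: "'i \<Rightarrow> nat \<Rightarrow> real \<times> real \<Rightarrow> real"
    and k :: nat
    and \<sigma> \<sigma>I :: "'i \<Rightarrow> real \<times> real \<Rightarrow> real \<times> real"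
    and u :: "'i \<Rightarrow> real \<times> real \<Rightarrow> real"
  assumes domain: "open \<Omega>" "connected \<Omega>" "bounded \<Omega>" "\<Omega> \<noteq> {}"
    and mesh: "\<And>i. is_mesh \<Omega> (M i)"
    and h_to_0: "((\<lambda>i. meshsize (M i)) \<longlongrightarrow> 0) F"
    and continuous: "eigen_enum \<Omega> (Hdiv \<Omega>) (L2 \<Omega>) {1..} lam sig us"
    and discrete: "\<And>i. eigen_enum \<Omega> (RT_space \<Omega> (M i)) (P0_space \<Omega> (M i)) {1..N i}
                          (lamh i) (sigh i) (uh i)"
    and k_pos: "1 \<le> k"
    and k_le: "\<forall>\<^sub>F i in F. k \<le> N i"
    and corr: "\<forall>\<^sub>F i in F. corresponding \<Omega> lam us (N i) (uh i) k (\<sigma> i) (u i)"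
    and regular: "\<forall>\<^sub>F i in F. u i \<in> sobolev 3 \<Omega>"
    and interp: "\<forall>\<^sub>F i in F. is_RT_interp \<Omega> (M i) (\<sigma> i) (\<sigma>I i)"
    and apriori_lam: "(\<lambda>i. lamh i k - lam k) \<in> O[F](\<lambda>i. meshsize (M i) ^ 2)"
    and apriori_sigma: "(\<lambda>i. L2_norm \<Omega> (\<lambda>z. sigh i k z - \<sigma> i z)) \<in> O[F](\<lambda>i. meshsize (M i))"
    and apriori_u: "(\<lambda>i. L2_norm \<Omega> (\<lambda>z. uh i k z - u i z)) \<in> O[F](\<lambda>i. meshsize (M i))"
  shows "(\<lambda>i. lamh i k - lam k - L2_inner \<Omega> (\<lambda>z. \<sigma> i z - \<sigma>I i z) (sigh i k))
           \<in> O[F](\<lambda>i. meshsize (M i) ^ 4)"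
proof -
  let ?E = "\<lambda>i. 1 / 2 * (lamh i k - lam k) * (L2_norm \<Omega> (\<lambda>z. uh i k z - u i z))\<^sup>2"
  have \<Omega>: "\<Omega> \<in> sets lebesgue" using domain by (simp add: borel_open)
  \<comment> \<open>As soon as \<open>k \<le> N i\<close>, the index \<open>k\<close> belongs to the
    discrete enumeration, which supplies the discrete solution and its normalisation.\<close>
  have ev: "\<forall>\<^sub>F i in F. lamh i k - lam k - L2_inner \<Omega> (\<lambda>z. \<sigma> i z - \<sigma>I i z) (sigh i k) = ?E i"
    using k_le corr interp
  proof eventually_elim
    case (elim i)
    then have "mixed_solution \<Omega> (RT_space \<Omega> (M i)) (P0_space \<Omega> (M i)) (lamh i k) (sigh i k) (uh i k)"
      "L2_inner \<Omega> (uh i k) (uh i k) = 1"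
      using discrete[of i] k_pos by (auto simp: eigen_enum_def)
    with elim show ?case
      by (intro eigenvalue_error_identity[OF mesh \<Omega>]) (auto simp: corresponding_def)
  qed
  \<comment> \<open>The eigenvalue error contributes two powers of the mesh size and the squared
    eigenfunction error the other two.\<close>
  have "(\<lambda>i. (1 / 2 * (lamh i k - lam k)) * (L2_norm \<Omega> (\<lambda>z. uh i k z - u i z))\<^sup>2)
      \<in> O[F](\<lambda>i. meshsize (M i) ^ 2 * meshsize (M i) ^ 2)"
    using apriori_lam apriori_u by (intro landau_o.big.mult landau_o.big_power) auto
  then have "?E \<in> O[F](\<lambda>i. meshsize (M i) ^ 4)"
    by (simp add: power_add[symmetric])
  then show ?thesis using landau_o.big.in_cong[OF ev] by blast
qed

end
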